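(* Consider the stationary decision model with infinite planning horizon and zero terminal cost described in the context. Assume the following. (1) The sets $D(x)$, $x\in E$, are compact and $x\mapsto D(x)$ is upper semicontinuous, i.e. if $x_k\to x$ in $E$ and $a_k\in D(x_k)$ for $k\in\mathbb N$, then $(a_k)$ has an accumulation point in $D(x)$; $(x,a)\mapsto T(x,a,z)$ is continuous on $D$ for every $z\in\mathcal Z$; $c:D\times E\to\mathbb R$ is lower semicontinuous. (2) There exist $\alpha,\underline\epsilon,\bar\epsilon\ge0$ with $\underline\epsilon+\bar\epsilon=1$ and measurable functions $\underline b:E\to(-\infty,-\underline\epsilon]$, $\bar b:E\to[\bar\epsilon,\infty)$ such that for all $(x,a)\in D$ $$\rho\big(c(x,a,T(x,a,Z))\big)\ge\underline b(x),\qquad \rho\big(-\underline b(T(x,a,Z))\big)\le-\alpha\underline b(x),$$ $$\rho\big(c(x,a,T(x,a,Z))\big)\le\bar b(x),\qquad \rho\big(\bar b(T(x,a,Z))\big)\le\alpha\bar b(x).$$ (3) Put $b=\bar b-\underline b:E\to[1,\infty)$. For all $(\bar x,\bar a)\in D$ there exist $\epsilon>0$ and measurable $\Theta_1^{\bar x,\bar a},\Theta_2^{\bar x,\bar a}:\mathcal Z\to\mathbb R_+$ with $\Theta_1^{\bar x,\bar a}(Z),\Theta_2^{\bar x,\bar a}(Z)\in L^p$ and $|c(x,a,T(x,a,z))|\le\Theta_1^{\bar x,\bar a}(z)$, $b(T(x,a,z))\le\Theta_2^{\bar x,\bar a}(z)$ for all $z\in\mathcal Z$ and all $(x,a)\in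 D$ in the closed ball of radius $\epsilon$ around $(\bar x,\bar a)$ (w.r.t. a product metric on $E\times A$). (4) The risk measure $\rho:L^p\to\bar{\mathbb R}$ is law invariant, proper, coherent and has the Fatou property. (5) $\alpha\beta<1$. Let $\underline{\mathbf b}=\frac{1}{1-\alpha\beta}\underline b$, $\bar{\mathbf b}=\frac1{1-\alpha\beta}\bar b$ and let $I=[\underline{\mathbf b},\bar{\mathbf b}]$ be the set of lower semicontinuous functions $v:E\to\mathbb R$ with $\underline{\mathbf b}\le v\le\bar{\mathbf b}$ pointwise. Then: a) The limit value function $J=\lim_{N\to\infty}J_N$ is the unique fixed point of the Bellman operator $\mathcal T$ in $I$. b) There exists a Markov decision rule $d^*$ such that $\mathcal T_{d^*}J=\mathcal TJ$. c) Each stationary policy $\pi^*=(d^*,d^*,\dots)$ induced by a Markov decision rule $d^*$ as in b) is optimal for the infinite horizon problem, i.e. $J_{\infty\pi^*}(x)=J_\infty(x)=\inf_{\pi\in\Pi^M}J_{\infty\pi}(x)$ for all $x\in E$, and $J_\infty=J$.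
   Context: Risk measures. Fix a probability space $(\Omega,\mathcal A,\mathbb P)$ and $p\in[1,\infty)$; $L^p=L^p(\Omega,\mathcal A,\mathbb P)$ (positive values are losses). A risk measure is a map $\rho:L^p\to\bar{\mathbb R}=[-\infty,\infty]$. Monetary: monotone ($X\le Y\Rightarrow\rho(X)\le\rho(Y)$) and translation invariant ($\rho(X+m)=\rho(X)+m$, $m\in\mathbb R$). Coherent: monetary, positive homogeneous ($\rho(\lambda X)=\lambda\rho(X)$ for $\lambda\in\mathbb R_+$) and subadditive ($\rho(X+Y)\le\rho(X)+\rho(Y)$). Proper: never $-\infty$ and $<+\infty$ at at least one point. Law invariant: $\rho(X)=\rho(Y)$ whenever $X,Y$ have the same distribution. Fatou property: for every sequence $(X_n)\subseteq L^p$ with $|X_n|\le Y$ a.s. for some $Y\in L^p$ and $X_n\to X\in L^p$ a.s., $\liminf_n\rho(X_n)\ge\rho(X)$. Stationary decision model. State space $E$ and action space $A$ are Borel spaces (Borel subsets of Polish spaces); $D\subseteq E\times A$ is measurable and contains the graph of a measurable map $E\to A$; $D(x)=\{a:(x,a)\in D\}$; $T:D\times\mathcal Z\to E$ is a measurable transition function; the disturbances are i.i.d. with values in a measurable space $(\mathcal Z,\mathfrak Z)$, and $Z$ denotes a representative of their distribution on $(\Omega,\mathcal A,\mathbb P)$; $c:D\times E\to\mathbb R$ is the one-stage cost; $\beta\in(0,1]$ is the discount factor; terminal cost is zero. A Markov decision rule is a measurable $d:E\to A$ with $d(x)\in D(x)$; $\Pi^M$ is the set of Markov policies $\pi=(d_0,d_1,\dots)$.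 Operators. For measurable $v:E\to\mathbb R$ with $|v|\le\lambda b$ for some $\lambda\in\mathbb R_+$ and a Markov decision rule $d$, $$\mathcal T_dv(x)=\rho\big(c(x,d(x),T(x,d(x),Z))+\beta v(T(x,d(x),Z))\big),$$ $$\mathcal Tv(x)=\inf_{a\in D(x)}\rho\big(c(x,a,T(x,a,Z))+\beta v(T(x,a,Z))\big).$$ Values. $J_{N\pi}=\mathcal T_{d_0}\circ\dots\circ\mathcal T_{d_{N-1}}0$ for $N\in\mathbb N$, $J_{0\pi}=0$; $J_N(x)=\inf_{\pi\in\Pi^M}J_{N\pi}(x)$; $J_{\infty\pi}(x)=\lim_{N\to\infty}J_{N\pi}(x)$; $J_\infty(x)=\inf_{\pi\in\Pi^M}J_{\infty\pi}(x)$; $J(x)=\lim_{N\to\infty}J_N(x)$. (Under the stated assumptions these limits exist.) It is assumed throughout that $\rho$ is such that all policy values $J_{N\pi}$ are measurable. *)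

theory Defs
  imports "HOL-Probability.Probability"
begin

section \<open>Risk measures on $L^p$\<close>

text \<open>Elements of $L^p$ are represented by functions. A risk measure is a function
  on all of \<^typ>\<open>'w \<Rightarrow> real\<close>, of which only the values on \<open>Lp M p\<close> matter. Since monotonicity is
  required with respect to the almost sure order, such a function respects almost sure equality
  and hence is a function on equivalence classes.\<close>

definition Lp :: "'w measure \<Rightarrow> real \<Rightarrow> ('w \<Rightarrow> real) set" where
  "Lp M p = {X \<in> borel_measurable M. integrable M (\<lambda>w. \<bar>X w\<bar> powr p)}"

definition monetary :: "'w measure \<Rightarrow> real \<Rightarrow> (('w \<Rightarrow> real) \<Rightarrow> ereal) \<Rightarrow> bool" where
  "monetary M p \<rho> \<longleftrightarrow>
     (\<forall>X\<in>Lp M p. \<forall>Y\<in>Lp M p. (AE w in M. X w \<le> Y w) \<longrightarrow> \<rho> X \<le> \<rho> Y) \<and>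
     (\<forall>X\<in>Lp M p. \<forall>m. \<rho> (\<lambda>w. X w + m) = \<rho> X + ereal m)"

text \<open>In \<^typ>\<open>ereal\<close> we have $0 \cdot \infty = 0$, so positive homogeneity with factor $0$ says
  $\rho(0) = 0$. The value of $\infty + (-\infty)$ is irrelevant for proper risk measures.\<close>

definition coherent :: "'w measure \<Rightarrow> real \<Rightarrow> (('w \<Rightarrow> real) \<Rightarrow> ereal) \<Rightarrow> bool" where
  "coherent M p \<rho> \<longleftrightarrow> monetary M p \<rho> \<and>
     (\<forall>X\<in>Lp M p. \<forall>l\<ge>0. \<rho> (\<lambda>w. l * X w) = ereal l * \<rho> X) \<and>
     (\<forall>X\<in>Lp M p. \<forall>Y\<in>Lp M p. \<rho> (\<lambda>w. X w + Y w) \<le> \<rho> X + \<rho> Y)"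

definition proper :: "'w measure \<Rightarrow> real \<Rightarrow> (('w \<Rightarrow> real) \<Rightarrow> ereal) \<Rightarrow> bool" where
  "proper M p \<rho> \<longleftrightarrow> (\<forall>X\<in>Lp M p. \<rho> X \<noteq> -\<infinity>) \<and> (\<exists>X\<in>Lp M p. \<rho> X < \<infinity>)"

definition law_invariant :: "'w measure \<Rightarrow> real \<Rightarrow> (('w \<Rightarrow> real) \<Rightarrow> ereal) \<Rightarrow> bool" where
  "law_invariant M p \<rho> \<longleftrightarrow>
     (\<forall>X\<in>Lp M p. \<forall>Y\<in>Lp M p. distr M borel X = distr M borel Y \<longrightarrow> \<rho> X = \<rho> Y)"

definition Fatou_property :: "'w measure \<Rightarrow> real \<Rightarrow> (('w \<Rightarrow> real) \<Rightarrow> ereal) \<Rightarrow> bool" where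
  "Fatou_property M p \<rho> \<longleftrightarrow>
     (\<forall>Xs. \<forall>X\<in>Lp M p. \<forall>Y\<in>Lp M p.
        (\<forall>n::nat. Xs n \<in> Lp M p) \<longrightarrow>
        (\<forall>n. AE w in M. \<bar>Xs n w\<bar> \<le> Y w) \<longrightarrow>
        (AE w in M. (\<lambda>n. Xs n w) \<longlonglongrightarrow> X w) \<longrightarrow>
        \<rho> X \<le> liminf (\<lambda>n. \<rho> (Xs n)))"


section \<open>Semicontinuity\<close>

definition lsc_on :: "'x::topological_space set \<Rightarrow> ('x \<Rightarrow> real) \<Rightarrow> bool" where
  "lsc_on S f \<longleftrightarrow> (\<forall>x\<in>S. \<forall>t. t < f x \<longrightarrow> (\<forall>\<^sub>F y in at x within S. t < f y))"

text \<open>A set-valued map $x \mapsto D(x)$ is represented by its graph \<open>D\<close>, so that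
  $D(x)$ is \<open>D `` {x}\<close>.\<close>

definition usc_set_valued_on ::
    "'e::topological_space set \<Rightarrow> ('e \<times> 'a::topological_space) set \<Rightarrow> bool" where
  "usc_set_valued_on E D \<longleftrightarrow>
     (\<forall>x\<in>E. \<forall>xs as. (\<forall>k::nat. xs k \<in> E) \<longrightarrow> xs \<longlonglongrightarrow> x \<longrightarrow> (\<forall>k. as k \<in> D `` {xs k}) \<longrightarrow>
        (\<exists>a\<in>D `` {x}. \<exists>r. strict_mono r \<and> (as \<circ> r) \<longlonglongrightarrow> a))"

definition lsc_between :: "'e::topological_space set \<Rightarrow> ('e \<Rightarrow> real) \<Rightarrow> ('e \<Rightarrow> real) \<Rightarrow> ('e \<Rightarrow> real) set" where
  "lsc_between E l u = {v. lsc_on E v \<and> (\<forall>x\<in>E. l x \<le> v x \<and> v x \<le> u x)}"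


section \<open>Policies and values\<close>

text \<open>Functions on the state space \<open>E\<close> are total functions; their values outside \<open>E\<close> play no role.\<close>

definition decision_rules ::
    "'e::topological_space set \<Rightarrow> 'a::topological_space set \<Rightarrow> ('e \<times> 'a) set \<Rightarrow> ('e \<Rightarrow> 'a) set" where
  "decision_rules E A D =
     {d \<in> restrict_space borel E \<rightarrow>\<^sub>M restrict_space borel A. \<forall>x\<in>E. d x \<in> D `` {x}}"

definition Markov_policies ::
    "'e::topological_space set \<Rightarrow> 'a::topological_space set \<Rightarrow> ('e \<times> 'a) set \<Rightarrow> (nat \<Rightarrow> 'e \<Rightarrow> 'a) set" where
  "Markov_policies E A D = {\<pi>. \<forall>n. \<pi> n \<in> decision_rules E A D}"

definition stage_risk ::
    "(('w \<Rightarrow> real) \<Rightarrow> ereal) \<Rightarrow> ('e \<Rightarrow> 'a \<Rightarrow> 'z \<Rightarrow> 'e) \<Rightarrow> ('w \<Rightarrow> 'z) \<Rightarrow> ('e \<Rightarrow> 'a \<Rightarrow> 'e \<Rightarrow> real) \<Rightarrow> real \<Rightarrow>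
     ('e \<Rightarrow> real) \<Rightarrow> 'e \<Rightarrow> 'a \<Rightarrow> ereal" where
  "stage_risk \<rho> T Z c \<beta> v x a = \<rho> (\<lambda>w. c x a (T x a (Z w)) + \<beta> * v (T x a (Z w)))"

definition rule_operator ::
    "(('w \<Rightarrow> real) \<Rightarrow> ereal) \<Rightarrow> ('e \<Rightarrow> 'a \<Rightarrow> 'z \<Rightarrow> 'e) \<Rightarrow> ('w \<Rightarrow> 'z) \<Rightarrow> ('e \<Rightarrow> 'a \<Rightarrow> 'e \<Rightarrow> real) \<Rightarrow> real \<Rightarrow>
     ('e \<Rightarrow> 'a) \<Rightarrow> ('e \<Rightarrow> real) \<Rightarrow> 'e \<Rightarrow> ereal" where
  "rule_operator \<rho> T Z c \<beta> d v x = stage_risk \<rho> T Z c \<beta> v x (d x)"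

definition Bellman_operator ::
    "(('w \<Rightarrow> real) \<Rightarrow> ereal) \<Rightarrow> ('e \<times> 'a) set \<Rightarrow> ('e \<Rightarrow> 'a \<Rightarrow> 'z \<Rightarrow> 'e) \<Rightarrow> ('w \<Rightarrow> 'z) \<Rightarrow>
     ('e \<Rightarrow> 'a \<Rightarrow> 'e \<Rightarrow> real) \<Rightarrow> real \<Rightarrow> ('e \<Rightarrow> real) \<Rightarrow> 'e \<Rightarrow> ereal" where
  "Bellman_operator \<rho> D T Z c \<beta> v x = (INF a\<in>D `` {x}. stage_risk \<rho> T Z c \<beta> v x a)"

text \<open>The operators act on real-valued functions but may have infinite values, hence the
  \<^const>\<open>real_of_ereal\<close> in the iteration. It is only meaningful when the policy values are finite.\<close>

primrec policy_value ::
    "(('w \<Rightarrow> real) \<Rightarrow> ereal) \<Rightarrow> ('e \<Rightarrow> 'a \<Rightarrow> 'z \<Rightarrow> 'e) \<Rightarrow> ('w \<Rightarrow> 'z) \<Rightarrow> ('e \<Rightarrow> 'a \<Rightarrow> 'e \<Rightarrow> real) \<Rightarrow> real \<Rightarrow>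
     nat \<Rightarrow> (nat \<Rightarrow> 'e \<Rightarrow> 'a) \<Rightarrow> 'e \<Rightarrow> ereal" where
  "policy_value \<rho> T Z c \<beta> 0 \<pi> = (\<lambda>x. 0)"
| "policy_value \<rho> T Z c \<beta> (Suc N) \<pi> =
     rule_operator \<rho> T Z c \<beta> (\<pi> 0) (\<lambda>y. real_of_ereal (policy_value \<rho> T Z c \<beta> N (\<lambda>n. \<pi> (Suc n)) y))"

definition horizon_value ::
    "(('w \<Rightarrow> real) \<Rightarrow> ereal) \<Rightarrow> 'e::topological_space set \<Rightarrow> 'a::topological_space set \<Rightarrow> ('e \<times> 'a) set \<Rightarrow>
     ('e \<Rightarrow> 'a \<Rightarrow> 'z \<Rightarrow> 'e) \<Rightarrow> ('w \<Rightarrow> 'z) \<Rightarrow> ('e \<Rightarrow> 'a \<Rightarrow> 'e \<Rightarrow> real) \<Rightarrow> real \<Rightarrow> nat \<Rightarrow> 'e \<Rightarrow> ereal" where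
  "horizon_value \<rho> E A D T Z c \<beta> N x = (INF \<pi>\<in>Markov_policies E A D. policy_value \<rho> T Z c \<beta> N \<pi> x)"

definition policy_value_inf ::
    "(('w \<Rightarrow> real) \<Rightarrow> ereal) \<Rightarrow> ('e \<Rightarrow> 'a \<Rightarrow> 'z \<Rightarrow> 'e) \<Rightarrow> ('w \<Rightarrow> 'z) \<Rightarrow> ('e \<Rightarrow> 'a \<Rightarrow> 'e \<Rightarrow> real) \<Rightarrow> real \<Rightarrow>
     (nat \<Rightarrow> 'e \<Rightarrow> 'a) \<Rightarrow> 'e \<Rightarrow> ereal" where
  "policy_value_inf \<rho> T Z c \<beta> \<pi> x = lim (\<lambda>N. policy_value \<rho> T Z c \<beta> N \<pi> x)"

definition value_inf ::
    "(('w \<Rightarrow> real) \<Rightarrow> ereal) \<Rightarrow> 'e::topological_space set \<Rightarrow> 'a::topological_space set \<Rightarrow> ('e \<times> 'a) set \<Rightarrow>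
     ('e \<Rightarrow> 'a \<Rightarrow> 'z \<Rightarrow> 'e) \<Rightarrow> ('w \<Rightarrow> 'z) \<Rightarrow> ('e \<Rightarrow> 'a \<Rightarrow> 'e \<Rightarrow> real) \<Rightarrow> real \<Rightarrow> 'e \<Rightarrow> ereal" where
  "value_inf \<rho> E A D T Z c \<beta> x = (INF \<pi>\<in>Markov_policies E A D. policy_value_inf \<rho> T Z c \<beta> \<pi> x)"

end

theory Submission
  imports Defs
begin

text \<open>Relative to the weight $b$, the operators are contractions with modulus $\alpha\beta$ on the functions
  between the two bounds, so the iterates $\mathcal T^N 0$ and the policy values converge geometrically.
  By Fatou's property the stage risk is lower semicontinuous on $D$; hence $\mathcal T$ has
  measurable minimizers, and $J_N = \mathcal T^N 0$ is attained by a Markov policy.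

  As $b$ is only measurable, lower semicontinuity of $J$ does not follow from the uniform
  convergence relative to $b$. It is preserved, however, along sequences on which $b$ is bounded, and this suffices
  to make the stage risk of $J$, and thus $\mathcal T J = J$, lower semicontinuous, because $b$ is bounded along the
  successor states of a convergent sequence of state-action pairs.\<close>

section \<open>Semicontinuity and measurable selection\<close>

text \<open>A coherent risk measure is only subadditive, so it supports estimates from above alone.
  Each bound and each Lipschitz estimate is therefore obtained by dominating one position by another
  plus a nonnegative multiple of \<open>b\<close>, \<open>bu\<close> or \<open>- bl\<close> at the
  successor state; the drift conditions turn the risk of that extra term into a multiple of the same
  function at the current state. Two classes of functions are kept apart. Values of arbitrary
  policies are merely measurable, so the estimates are proved in \<open>bounded_values\<close>;
  minimizers need semicontinuity, so value iteration runs inside the smaller class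
  \<open>admissible\<close>. Every geometric estimate starts from the value 0: all functions in
  either class satisfy |v| <= K b. Fatou's property asks for a common dominating element of L^p. It
  comes from the local bounds near a state-action pair, which is why semicontinuity is tested along
  convergent sequences of pairs, for each outcome of the disturbance separately.\<close>

lemma closedin_sequentialI:
  fixes S :: "'a::first_countable_topology set"
  assumes "S \<subseteq> E"
    and "\<And>xs x. (\<And>n::nat. xs n \<in> S) \<Longrightarrow> xs \<longlonglongrightarrow> x \<Longrightarrow> x \<in> E \<Longrightarrow> x \<in> S"
  shows "closedin (top_of_set E) S"
  unfolding closedin_limpt islimpt_sequential using assms by blast

lemma closedin_sets_restrict_borel:
  "closedin (top_of_set E) S \<Longrightarrow> S \<in> sets (restrict_space borel E)"
  by (auto simp: closedin_closed sets_restrict_space)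

lemma lsc_onI_closedin:
  assumes "\<And>t. closedin (top_of_set S) {x\<in>S. f x \<le> t}"
  shows "lsc_on S f"
  unfolding lsc_on_def
proof (intro ballI allI impI)
  fix x t assume x: "x \<in> S" "t < f x"
  from assms[of t] obtain C where C: "closed C" "{x\<in>S. f x \<le> t} = S \<inter> C"
    by (auto simp: closedin_closed)
  have "open (- C)" using C by auto
  moreover have "x \<in> - C" using C(2) x by (metis ComplI IntI leD mem_Collect_eq)
  moreover have "\<forall>y\<in>- C. y \<noteq> x \<longrightarrow> y \<in> S \<longrightarrow> t < f y" using C(2) by force
  ultimately show "\<forall>\<^sub>F y in at x within S. t < f y"
    unfolding eventually_at_topological by blast
qed

lemma lsc_onD_sequentially:
  assumes f: "lsc_on S f" and x: "x \<in> S" and xs: "\<And>n::nat. xs n \<in> S" "xs \<longlonglongrightarrow> x" and t: "t < f x"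
  shows "\<forall>\<^sub>F n in sequentially. t < f (xs n)"
proof -
  from f x t have "\<forall>\<^sub>F y in at x within S. t < f y" by (auto simp: lsc_on_def)
  then obtain U where U: "open U" "x \<in> U" "\<And>y. y \<in> U \<Longrightarrow> y \<noteq> x \<Longrightarrow> y \<in> S \<Longrightarrow> t < f y"
    unfolding eventually_at_topological by blast
  from topological_tendstoD[OF xs(2) U(1,2)] show ?thesis
    by eventually_elim (metis U(3) t xs(1))
qed

text \<open>A single index suffices in the premise because it is applied to sequences lying entirely
  in a sublevel set of f: one term above t already contradicts that.\<close>

lemma lsc_onI_sequentially:
  fixes S :: "'a::first_countable_topology set"
  assumes "\<And>x xs t. x \<in> S \<Longrightarrow> (\<And>n::nat. xs n \<in> S) \<Longrightarrow> xs \<longlonglongrightarrow> x \<Longrightarrow> t < f x \<Longrightarrow>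
    \<exists>n. t < f (xs n)"
  shows "lsc_on S f"
proof (rule lsc_onI_closedin, rule closedin_sequentialI)
  fix t xs x assume "\<And>n::nat. xs n \<in> {x \<in> S. f x \<le> t}" "xs \<longlonglongrightarrow> x" "x \<in> S"
  with assms[of x xs t] show "x \<in> {x \<in> S. f x \<le> t}"
    by (metis (mono_tags, lifting) leD leI mem_Collect_eq)
qed auto

lemma lsc_on_measurable:
  assumes "lsc_on S f"
  shows "f \<in> borel_measurable (restrict_space borel S)"
proof (rule borel_measurableI_greater)
  fix t
  have "\<exists>U. open U \<and> x \<in> U \<and> (\<forall>y\<in>U \<inter> S. t < f y)" if "x \<in> S" "t < f x" for x
    using assms that unfolding lsc_on_def eventually_at_topological by (metis IntD1 IntD2)
  then have "\<exists>T. openin (top_of_set S) T \<and> x \<in> T \<and> T \<subseteq> {x\<in>S. t < f x}" if "x \<in> S" "t < f x" for x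
    using that by (metis (no_types, lifting) Int_commute IntI Int_iff mem_Collect_eq openin_open_Int subsetI)
  then have "openin (top_of_set S) {x\<in>S. t < f x}"
    by (subst openin_subopen) blast
  then obtain U where "open U" "{x\<in>S. t < f x} = S \<inter> U" by (auto simp: openin_open)
  then show "{x \<in> space (restrict_space borel S). t < f x} \<in> sets (restrict_space borel S)"
    by (simp add: space_restrict_space sets_restrict_space)
qed

lemma lsc_on_subset: "lsc_on S f \<Longrightarrow> R \<subseteq> S \<Longrightarrow> lsc_on R f"
  unfolding lsc_on_def by (meson at_le filter_leD subsetD)

section \<open>Measurable selection from compact-valued maps\<close>

text \<open>A list of indices encodes successive approximations, the latest one at the head.\<close>

fun cball_code :: "(nat \<Rightarrow> 'a::metric_space) \<Rightarrow> nat list \<Rightarrow> 'a set" where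
  "cball_code e [] = UNIV"
| "cball_code e (i # l) = cball (e i) (inverse (real (Suc (length l)))) \<inter> cball_code e l"

lemma closed_cball_code: "closed (cball_code e l)"
  by (induction l) auto

text \<open>A selection of Kuratowski and Ryll-Nardzewski type. At each stage the first dense point
  is taken whose small closed ball, intersected with the earlier balls, still meets \<Phi> x.
  Compactness of \<Phi> x gives a point common to all the balls, and as the radii tend to 0 there is
  only one.\<close>

theorem measurable_selection_compact:
  fixes \<Phi> :: "'x \<Rightarrow> 'a::{metric_space, second_countable_topology} set"
  assumes compact: "\<And>x. x \<in> space M \<Longrightarrow> compact (\<Phi> x)"
    and nonempty: "\<And>x. x \<in> space M \<Longrightarrow> \<Phi> x \<noteq> {}"
    and hit: "\<And>F. closed F \<Longrightarrow> {x\<in>space M. \<Phi> x \<inter> F \<noteq> {}} \<in> sets M"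
  obtains d where "d \<in> borel_measurable M" "\<And>x. x \<in> space M \<Longrightarrow> d x \<in> \<Phi> x"
proof -
  obtain Y :: "'a set" where Y: "countable Y" "\<And>U. open U \<Longrightarrow> U \<noteq> {} \<Longrightarrow> \<exists>y\<in>Y. y \<in> U"
    by (erule countable_dense_setE)
  define e where "e = from_nat_into Y"
  have near: "\<exists>i. y \<in> cball (e i) \<epsilon>" if "\<epsilon> > 0" for y \<epsilon>
  proof -
    have "ball y \<epsilon> \<noteq> {}" using that by auto
    from Y(2)[OF open_ball this] obtain u where u: "u \<in> Y" "u \<in> ball y \<epsilon>" by auto
    then obtain i where "u = e i" unfolding e_def by (metis Y(1) from_nat_into_surj)
    then show ?thesis using u by (auto simp: dist_commute intro!: exI[of _ i])
  qed
  define s where "s = rec_nat (\<lambda>_. []) (\<lambda>n f x. (LEAST i. \<Phi> x \<inter> cball_code e (i # f x) \<noteq> {}) # f x)"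
  have s0: "s 0 x = []" and sS: "s (Suc n) x = (LEAST i. \<Phi> x \<inter> cball_code e (i # s n x) \<noteq> {}) # s n x" for n x
    by (auto simp: s_def)
  have len: "length (s n x) = n" for n x
    by (induction n) (auto simp: s0 sS)
  have meets: "\<Phi> x \<inter> cball_code e (s n x) \<noteq> {}" if x: "x \<in> space M" for n x
  proof (induction n)
    case 0
    then show ?case using nonempty[OF x] by (simp add: s0)
  next
    case (Suc n)
    then obtain y where y: "y \<in> \<Phi> x" "y \<in> cball_code e (s n x)" by auto
    obtain i where "y \<in> cball (e i) (inverse (real (Suc n)))" using near[of "inverse (real (Suc n))" y] by auto
    then have "\<Phi> x \<inter> cball_code e (i # s n x) \<noteq> {}"
      using y by (auto simp: len)
    then show ?case unfolding sS by (rule LeastI)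
  qed
  have s_measurable: "s n \<in> M \<rightarrow>\<^sub>M count_space UNIV" for n
  proof (induction n)
    case 0
    then show ?case by (simp add: s0[abs_def])
  next
    case (Suc n)
    \<comment> \<open>The earlier choices are first frozen to a list l: then each condition on i
      defines a measurable set by \<open>hit\<close>. The dependence of l on x is restored
      afterwards, since there are only countably many lists.\<close>
    have "(\<lambda>x. LEAST i. \<Phi> x \<inter> cball_code e (i # l) \<noteq> {}) \<in> M \<rightarrow>\<^sub>M count_space UNIV" for l
      by (intro measurableI sets_Least hit closed_cball_code) auto
    from measurable_compose[OF this, of "\<lambda>i. i # l" "count_space UNIV" for l]
    have "(\<lambda>x. (LEAST i. \<Phi> x \<inter> cball_code e (i # l) \<noteq> {}) # l) \<in> M \<rightarrow>\<^sub>M count_space UNIV" for l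
      by simp
    from measurable_compose_countable[OF this Suc] show ?case
      by (simp add: sS[abs_def])
  qed
  have "\<exists>a\<in>\<Phi> x. \<forall>n. a \<in> cball_code e (s n x)" if x: "x \<in> space M" for x
  proof -
    have "\<forall>n. \<exists>y. y \<in> \<Phi> x \<inter> cball_code e (s n x)" using meets[OF x] by blast
    from choice[OF this] obtain q where q: "\<And>n. q n \<in> \<Phi> x \<inter> cball_code e (s n x)" by blast
    have dec: "cball_code e (s n x) \<subseteq> cball_code e (s m x)" if "m \<le> n" for m n
      by (rule lift_Suc_antimono_le[OF _ that]) (auto simp: sS)
    have "seq_compact (\<Phi> x)" using compact[OF x] by (simp add: compact_eq_seq_compact_metric)
    then obtain a r where a: "a \<in> \<Phi> x" "strict_mono r" "(q \<circ> r) \<longlonglongrightarrow> a"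
      using q by (auto elim!: seq_compactE[of _ q])
    have "a \<in> cball_code e (s n x)" for n
    proof (rule Lim_in_closed_set[OF closed_cball_code _ _ a(3)])
      show "\<forall>\<^sub>F k in sequentially. (q \<circ> r) k \<in> cball_code e (s n x)"
        using eventually_ge_at_top[of n]
      proof eventually_elim
        case (elim k)
        then have "n \<le> r k" using seq_suble[OF a(2), of k] by linarith
        then show ?case using q[of "r k"] dec[of n "r k"] by auto
      qed
    qed simp
    then show ?thesis using a by auto
  qed
  then obtain d where d: "\<And>x. x \<in> space M \<Longrightarrow> d x \<in> \<Phi> x \<and> (\<forall>n. d x \<in> cball_code e (s n x))"
    by metis
  \<comment> \<open>The pointwise choice of d carries no measurability by itself. It is the limit of
    the ball centres, which are measurable because they depend on x through the index lists
    only.\<close>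
  have "d \<in> borel_measurable M"
  proof (rule borel_measurable_LIMSEQ_metric)
    show "(\<lambda>x. e (hd (s (Suc n) x))) \<in> borel_measurable M" for n
      by (rule measurable_compose[OF s_measurable]) auto
    fix x assume "x \<in> space M"
    then have "d x \<in> cball_code e (s (Suc n) x)" for n using d by blast
    then have "dist (e (hd (s (Suc n) x))) (d x) \<le> inverse (real (Suc n))" for n
      by (simp add: sS len)
    then show "(\<lambda>n. e (hd (s (Suc n) x))) \<longlonglongrightarrow> d x"
      unfolding tendsto_dist_iff[of _ "d x"]
      by (intro tendsto_sandwich[OF _ _ tendsto_const LIMSEQ_inverse_real_of_nat]) auto
  qed
  with d show ?thesis using that by blast
qed

section \<open>Minimizing a semicontinuous function over the sections of D\<close>

locale parametric_minimization =
  fixes E :: "'e::metric_space set"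
    and D :: "('e \<times> 'a::{metric_space, second_countable_topology}) set"
    and f :: "'e \<Rightarrow> 'a \<Rightarrow> ereal"
  assumes usc: "usc_set_valued_on E D"
    and sections_nonempty: "\<And>x. x \<in> E \<Longrightarrow> D `` {x} \<noteq> {}"
    and f_lsc: "\<And>x a xs as. (x, a) \<in> D \<Longrightarrow> x \<in> E \<Longrightarrow> (\<And>k::nat. (xs k, as k) \<in> D) \<Longrightarrow> (\<And>k. xs k \<in> E) \<Longrightarrow>
      xs \<longlonglongrightarrow> x \<Longrightarrow> as \<longlonglongrightarrow> a \<Longrightarrow> f x a \<le> liminf (\<lambda>k. f (xs k) (as k))"
begin

text \<open>The closed set F is a parameter so that the sets on which the minimizers meet F can be
  described by comparing two minima, over F and over the whole section.\<close>

definition min_over :: "'a set \<Rightarrow> 'e \<Rightarrow> ereal" where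
  "min_over F x = (INF a\<in>D `` {x} \<inter> F. f x a)"

text \<open>This serves three purposes. With constant s it shows that sublevel sets in x are closed;
  with constant xs and a minimizing sequence it shows that the minimum is attained; with both
  constant it shows that the set of minimizers is compact.\<close>

lemma accumulation:
  assumes "x \<in> E" "\<And>k::nat. xs k \<in> E" "xs \<longlonglongrightarrow> x" "\<And>k. as k \<in> D `` {xs k} \<inter> F" "closed F"
    "\<And>k. f (xs k) (as k) \<le> s k" "s \<longlonglongrightarrow> t"
  obtains a r where "a \<in> D `` {x} \<inter> F" "strict_mono r" "(as \<circ> r) \<longlonglongrightarrow> a" "f x a \<le> t"
proof -
  obtain a r where ar: "a \<in> D `` {x}" "strict_mono r" "(as \<circ> r) \<longlonglongrightarrow> a"
    using usc assms(1-4) unfolding usc_set_valued_on_def by blast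
  have "a \<in> F"
    by (rule closed_sequentially[OF assms(5) _ ar(3)]) (use assms(4) in auto)
  have "f x a \<le> liminf (\<lambda>k. f ((xs \<circ> r) k) ((as \<circ> r) k))"
  proof (rule f_lsc)
    show "(xs \<circ> r) \<longlonglongrightarrow> x" by (rule LIMSEQ_subseq_LIMSEQ[OF assms(3) ar(2)])
    show "(as \<circ> r) \<longlonglongrightarrow> a" by (rule ar(3))
    show "((xs \<circ> r) k, (as \<circ> r) k) \<in> D" for k using assms(4)[of "r k"] by simp
  qed (use ar assms in auto)
  also have "\<dots> \<le> liminf (s \<circ> r)"
    by (rule Liminf_mono) (auto simp: assms(6))
  also have "\<dots> = t"
    by (intro lim_imp_Liminf LIMSEQ_subseq_LIMSEQ assms ar) auto
  finally show ?thesis using that ar \<open>a \<in> F\<close> by blast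
qed

lemma closedin_sublevel:
  assumes F: "closed F"
  shows "closedin (top_of_set E) {x\<in>E. \<exists>a\<in>D `` {x} \<inter> F. f x a \<le> t}"
proof (rule closedin_sequentialI)
  fix xs x assume xs: "\<And>n::nat. xs n \<in> {x\<in>E. \<exists>a\<in>D `` {x} \<inter> F. f x a \<le> t}" "xs \<longlonglongrightarrow> x" "x \<in> E"
  then have "\<forall>n. \<exists>a. a \<in> D `` {xs n} \<inter> F \<and> f (xs n) a \<le> t" by blast
  from choice[OF this] obtain as where "\<And>n. as n \<in> D `` {xs n} \<inter> F \<and> f (xs n) (as n) \<le> t" by blast
  then obtain a where "a \<in> D `` {x} \<inter> F" "f x a \<le> t"
    using accumulation[of x xs as F "\<lambda>_. t" t thesis] F xs by auto
  then show "x \<in> {x\<in>E. \<exists>a\<in>D `` {x} \<inter> F. f x a \<le> t}" using xs by blast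
qed auto

lemma min_over_attained:
  assumes F: "closed F" and x: "x \<in> E" and ne: "D `` {x} \<inter> F \<noteq> {}"
  obtains a where "a \<in> D `` {x} \<inter> F" "f x a = min_over F x"
proof -
  obtain u :: "nat \<Rightarrow> ereal" where u: "decseq u" "range u \<subseteq> f x ` (D `` {x} \<inter> F)"
      "Inf (f x ` (D `` {x} \<inter> F)) = (INF n. u n)"
    using Inf_countable_INF[of "f x ` (D `` {x} \<inter> F)"] ne by auto
  have lim: "u \<longlonglongrightarrow> min_over F x"
    unfolding min_over_def u(3) by (rule LIMSEQ_INF[OF u(1)])
  from u(2) have "\<forall>n. \<exists>a. a \<in> D `` {x} \<inter> F \<and> f x a \<le> u n"
    by (metis (mono_tags, lifting) image_iff order_refl range_subsetD)
  from choice[OF this] obtain as where as: "\<And>n. as n \<in> D `` {x} \<inter> F" "\<And>n. f x (as n) \<le> u n" by blast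
  obtain a where a: "a \<in> D `` {x} \<inter> F" "f x a \<le> min_over F x"
    by (rule accumulation[of x "\<lambda>_. x" as F u, OF x x _ as(1) F as(2) lim]) auto
  moreover have "min_over F x \<le> f x a" unfolding min_over_def by (rule INF_lower) (use a in auto)
  ultimately show ?thesis using that by force
qed

lemma min_over_le_iff:
  assumes "closed F" "x \<in> E" "D `` {x} \<inter> F \<noteq> {}"
  shows "min_over F x \<le> t \<longleftrightarrow> (\<exists>a\<in>D `` {x} \<inter> F. f x a \<le> t)"
proof
  assume "min_over F x \<le> t"
  then show "\<exists>a\<in>D `` {x} \<inter> F. f x a \<le> t"
    by (metis min_over_attained[OF assms])
next
  show "\<exists>a\<in>D `` {x} \<inter> F. f x a \<le> t \<Longrightarrow> min_over F x \<le> t"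
    unfolding min_over_def by (meson INF_lower order_trans)
qed

lemma closedin_min_over_le: "closedin (top_of_set E) {x\<in>E. min_over UNIV x \<le> t}"
proof -
  have "{x\<in>E. min_over UNIV x \<le> t} = {x\<in>E. \<exists>a\<in>D `` {x} \<inter> UNIV. f x a \<le> t}"
    using min_over_le_iff[of UNIV] sections_nonempty by auto
  then show ?thesis using closedin_sublevel[of UNIV t] by simp
qed

lemma min_over_measurable:
  assumes F: "closed F"
  shows "min_over F \<in> borel_measurable (restrict_space borel E)"
proof (rule borel_measurableI_le)
  fix t :: ereal
  show "{x \<in> space (restrict_space borel E). min_over F x \<le> t} \<in> sets (restrict_space borel E)"
  \<comment> \<open>The infimum over an empty set is \<infinity>, so for t < \<infinity> the states
    without an action in F drop out on both sides. For t = \<infinity> the set is the whole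
    space.\<close>
  proof (cases "t = \<infinity>")
    case False
    have "min_over F x = \<infinity>" if "D `` {x} \<inter> F = {}" for x
      unfolding min_over_def that by (simp add: top_ereal_def)
    then have "{x \<in> E. min_over F x \<le> t} = {x\<in>E. \<exists>a\<in>D `` {x} \<inter> F. f x a \<le> t}"
      using min_over_le_iff[OF F] False by (force simp: top_unique)
    then show ?thesis
      using closedin_sets_restrict_borel[OF closedin_sublevel[OF F]] by (simp add: space_restrict_space)
  qed auto
qed

lemma measurable_minimizer:
  obtains d where "d \<in> restrict_space borel E \<rightarrow>\<^sub>M borel"
    "\<And>x. x \<in> E \<Longrightarrow> d x \<in> D `` {x} \<and> f x (d x) = min_over UNIV x"
proof -
  define \<Phi> where "\<Phi> x = {a\<in>D `` {x}. f x a = min_over UNIV x}" for x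
  have \<Phi>: "\<Phi> x = {a\<in>D `` {x}. f x a \<le> min_over UNIV x}" for x
    unfolding \<Phi>_def min_over_def by (auto intro!: antisym INF_lower)
  have sp: "space (restrict_space borel E) = E" by (simp add: space_restrict_space)
  obtain d where "d \<in> borel_measurable (restrict_space borel E)" "\<And>x. x \<in> E \<Longrightarrow> d x \<in> \<Phi> x"
  proof (rule measurable_selection_compact[of "restrict_space borel E" \<Phi>, unfolded sp])
    fix x assume x: "x \<in> E"
    show "\<Phi> x \<noteq> {}"
      using min_over_attained[of UNIV x] sections_nonempty[OF x] x by (auto simp: \<Phi>_def)
    show "compact (\<Phi> x)"
      unfolding compact_eq_seq_compact_metric
    proof (rule seq_compactI)
      fix as assume as: "\<forall>n::nat. as n \<in> \<Phi> x"
      show "\<exists>l\<in>\<Phi> x. \<exists>r. strict_mono r \<and> (as \<circ> r) \<longlonglongrightarrow> l"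
        by (rule accumulation[of x "\<lambda>_. x" as UNIV "\<lambda>_. min_over UNIV x" "min_over UNIV x"])
          (use as x in \<open>auto simp: \<Phi>\<close>)
    qed
  next
    fix F :: "'a set" assume F: "closed F"
    \<comment> \<open>The bound \<infinity> in the first set is vacuous: that set collects the
      states with some action in F, written as a sublevel set so that its closedness is already
      known. It is needed because both minima may equal \<infinity> when there is no such
      action.\<close>
    have "{x\<in>E. \<Phi> x \<inter> F \<noteq> {}} =
      {x\<in>E. \<exists>a\<in>D `` {x} \<inter> F. f x a \<le> \<infinity>} \<inter> {x\<in>E. min_over F x \<le> min_over UNIV x}"
    proof (intro equalityI subsetI)
      fix x assume "x \<in> {x\<in>E. \<Phi> x \<inter> F \<noteq> {}}"
      then obtain a where "x \<in> E" "a \<in> D `` {x} \<inter> F" "f x a \<le> min_over UNIV x" unfolding \<Phi> by blast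
      with min_over_le_iff[OF F, of x "min_over UNIV x"]
      show "x \<in> {x\<in>E. \<exists>a\<in>D `` {x} \<inter> F. f x a \<le> \<infinity>} \<inter> {x\<in>E. min_over F x \<le> min_over UNIV x}" by auto
    next
      fix x assume "x \<in> {x\<in>E. \<exists>a\<in>D `` {x} \<inter> F. f x a \<le> \<infinity>} \<inter> {x\<in>E. min_over F x \<le> min_over UNIV x}"
      with min_over_le_iff[OF F, of x "min_over UNIV x"] show "x \<in> {x\<in>E. \<Phi> x \<inter> F \<noteq> {}}"
        unfolding \<Phi> by blast
    qed
    moreover have "{x\<in>space (restrict_space borel E). min_over F x \<le> min_over UNIV x} \<in> sets (restrict_space borel E)"
      by (intro borel_measurable_le min_over_measurable F) auto
    ultimately show "{x\<in>E. \<Phi> x \<inter> F \<noteq> {}} \<in> sets (restrict_space borel E)"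
      using closedin_sets_restrict_borel[OF closedin_sublevel[OF F, of \<infinity>]] unfolding sp by auto
  qed (rule that)
  then show ?thesis using that unfolding \<Phi>_def by blast
qed

end

section \<open>Coherent risk measures\<close>

lemma Lp_measurable: "X \<in> Lp M p \<Longrightarrow> X \<in> borel_measurable M"
  by (simp add: Lp_def)

lemma Lp_dominated:
  assumes "0 \<le> p" and Y: "Y \<in> Lp M p" and X: "X \<in> borel_measurable M"
    and le: "\<And>w. w \<in> space M \<Longrightarrow> \<bar>X w\<bar> \<le> Y w"
  shows "X \<in> Lp M p"
proof -
  have "integrable M (\<lambda>w. \<bar>X w\<bar> powr p)"
  proof (rule Bochner_Integration.integrable_bound)
    show "integrable M (\<lambda>w. \<bar>Y w\<bar> powr p)" using Y by (simp add: Lp_def)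
    show "AE w in M. norm (\<bar>X w\<bar> powr p) \<le> norm (\<bar>Y w\<bar> powr p)"
    proof (rule AE_I2)
      fix w assume "w \<in> space M"
      from le[OF this] have "\<bar>X w\<bar> \<le> \<bar>Y w\<bar>" by simp
      then show "norm (\<bar>X w\<bar> powr p) \<le> norm (\<bar>Y w\<bar> powr p)"
        using powr_mono2[OF \<open>0 \<le> p\<close> abs_ge_zero] by simp
    qed
  qed (use X in measurable)
  with X show ?thesis by (simp add: Lp_def)
qed

lemma Lp_cmult:
  assumes "X \<in> Lp M p"
  shows "(\<lambda>w. r * X w) \<in> Lp M p"
  using assms by (auto simp: Lp_def abs_mult powr_mult)

lemma Lp_add:
  assumes p: "0 \<le> p" and X: "X \<in> Lp M p" and Y: "Y \<in> Lp M p"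
  shows "(\<lambda>w. X w + Y w) \<in> Lp M p"
proof -
  have [measurable]: "X \<in> borel_measurable M" "Y \<in> borel_measurable M"
    using X Y by (auto simp: Lp_def)
  have "integrable M (\<lambda>w. \<bar>X w + Y w\<bar> powr p)"
  proof (rule Bochner_Integration.integrable_bound)
    show "integrable M (\<lambda>w. 2 powr p * (\<bar>X w\<bar> powr p + \<bar>Y w\<bar> powr p))"
      using X Y by (auto simp: Lp_def)
    show "AE w in M. norm (\<bar>X w + Y w\<bar> powr p) \<le> norm (2 powr p * (\<bar>X w\<bar> powr p + \<bar>Y w\<bar> powr p))"
    proof (rule AE_I2)
      fix w
      have "\<bar>X w + Y w\<bar> powr p \<le> (2 * max \<bar>X w\<bar> \<bar>Y w\<bar>) powr p"
        by (intro powr_mono2 p) auto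
      also have "\<dots> = 2 powr p * max \<bar>X w\<bar> \<bar>Y w\<bar> powr p"
        by (rule powr_mult)
      also have "\<dots> \<le> 2 powr p * (\<bar>X w\<bar> powr p + \<bar>Y w\<bar> powr p)"
        by (intro mult_left_mono) (auto simp: max_def)
      finally show "norm (\<bar>X w + Y w\<bar> powr p) \<le> norm (2 powr p * (\<bar>X w\<bar> powr p + \<bar>Y w\<bar> powr p))"
        by simp
    qed
  qed measurable
  then show ?thesis by (simp add: Lp_def)
qed

locale coherent_risk_measure =
  fixes M :: "'w measure" and p :: real and \<rho> :: "('w \<Rightarrow> real) \<Rightarrow> ereal"
  assumes p_nonneg: "0 \<le> p" and coherent: "coherent M p \<rho>"
    and Fatou: "Fatou_property M p \<rho>"
begin

lemma risk_mono:
  "X \<in> Lp M p \<Longrightarrow> Y \<in> Lp M p \<Longrightarrow> (\<And>w. w \<in> space M \<Longrightarrow> X w \<le> Y w) \<Longrightarrow> \<rho> X \<le> \<rho> Y"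
  using coherent by (auto simp: coherent_def monetary_def)

lemma risk_mult: "X \<in> Lp M p \<Longrightarrow> 0 \<le> r \<Longrightarrow> \<rho> (\<lambda>w. r * X w) = ereal r * \<rho> X"
  using coherent by (auto simp: coherent_def)

lemma risk_add: "X \<in> Lp M p \<Longrightarrow> Y \<in> Lp M p \<Longrightarrow> \<rho> (\<lambda>w. X w + Y w) \<le> \<rho> X + \<rho> Y"
  using coherent by (auto simp: coherent_def)

text \<open>Monotonicity, subadditivity and positive homogeneity combined in the form used for all
  later estimates of the stage risk, with U one of \<open>bu\<close>, \<open>- bl\<close>,
  \<open>b\<close> at the successor state and t its drift bound.\<close>

lemma risk_le_add_mult:
  assumes X: "X \<in> Lp M p" and Y: "Y \<in> Lp M p" and U: "U \<in> Lp M p" and r: "0 \<le> r"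
    and le: "\<And>w. w \<in> space M \<Longrightarrow> X w \<le> Y w + r * U w" and \<rho>U: "\<rho> U \<le> ereal t"
  shows "\<rho> X \<le> \<rho> Y + ereal (r * t)"
proof -
  have rU: "(\<lambda>w. r * U w) \<in> Lp M p" by (rule Lp_cmult[OF U])
  have "\<rho> X \<le> \<rho> (\<lambda>w. Y w + r * U w)"
    by (rule risk_mono[OF X Lp_add[OF p_nonneg Y rU] le])
  also have "\<dots> \<le> \<rho> Y + ereal r * \<rho> U"
    using risk_add[OF Y rU] risk_mult[OF U r] by simp
  also have "\<dots> \<le> \<rho> Y + ereal r * ereal t"
    by (intro add_left_mono ereal_mult_left_mono \<rho>U) (use r in auto)
  finally show ?thesis by simp
qed

text \<open>The Fatou property applies to the truncations $\min(X, X_n)$, which converge to $X$.\<close>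

lemma risk_le_liminf:
  assumes X: "X \<in> Lp M p" and Y: "Y \<in> Lp M p" and Xs: "\<And>n::nat. Xs n \<in> Lp M p"
    and bound: "\<And>n w. w \<in> space M \<Longrightarrow> \<bar>Xs n w\<bar> \<le> Y w"
    and below: "\<And>w t. w \<in> space M \<Longrightarrow> t < X w \<Longrightarrow> \<forall>\<^sub>F n in sequentially. t < Xs n w"
  shows "\<rho> X \<le> liminf (\<lambda>n. \<rho> (Xs n))"
proof -
  define U where "U n w = min (X w) (Xs n w)" for n w
  have absX: "(\<lambda>w. \<bar>X w\<bar>) \<in> Lp M p" using X by (auto simp: Lp_def)
  have dom: "(\<lambda>w. \<bar>X w\<bar> + Y w) \<in> Lp M p" by (rule Lp_add[OF p_nonneg absX Y])
  have le: "\<bar>U n w\<bar> \<le> \<bar>X w\<bar> + Y w" if "w \<in> space M" for n w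
    using bound[OF that, of n] by (auto simp: U_def min_def)
  have U: "U n \<in> Lp M p" for n
    using Lp_measurable[OF X] Lp_measurable[OF Xs[of n]]
    by (intro Lp_dominated[OF p_nonneg dom _ le]) (auto simp: U_def[abs_def])
  have "(\<lambda>n. U n w) \<longlonglongrightarrow> X w" if w: "w \<in> space M" for w
  proof (rule order_tendstoI)
    fix t assume "t < X w"
    with below[OF w this] show "\<forall>\<^sub>F n in sequentially. t < U n w"
      by (auto simp: U_def)
  next
    fix t assume "X w < t"
    then show "\<forall>\<^sub>F n in sequentially. U n w < t"
      by (auto simp: U_def min_less_iff_disj)
  qed
  then have "\<rho> X \<le> liminf (\<lambda>n. \<rho> (U n))"
    using Fatou[unfolded Fatou_property_def, rule_format, OF X dom, of U] U le by (blast intro: AE_I2)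
  also have "\<dots> \<le> liminf (\<lambda>n. \<rho> (Xs n))"
    by (intro Liminf_mono always_eventually allI risk_mono U Xs) (auto simp: U_def)
  finally show ?thesis .
qed

end

section \<open>The stationary decision model\<close>

text \<open>The error bound for the limit arises by letting j tend to infinity with n fixed. It is
  used with C = K * b x, both for policy values and for value iteration.\<close>

lemma geometric_tail_limit:
  fixes f :: "nat \<Rightarrow> real"
  assumes tail: "\<And>n j. \<bar>f (n + j) - f n\<bar> \<le> q ^ n * C" and q: "0 \<le> q" "q < 1"
  shows "f \<longlonglongrightarrow> lim f" "\<bar>lim f - f n\<bar> \<le> q ^ n * C"
proof -
  have null: "(\<lambda>n. q ^ n * C) \<longlonglongrightarrow> 0"
    using tendsto_mult_left_zero[OF LIMSEQ_power_zero, of q C] q by simp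
  have "Cauchy f"
  proof (rule CauchyI')
    fix \<epsilon> :: real assume "0 < \<epsilon>"
    then obtain N where N: "\<And>n. n \<ge> N \<Longrightarrow> q ^ n * C < \<epsilon>"
      using order_tendstoD(2)[OF null] by (auto simp: eventually_sequentially)
    have "dist (f m) (f n) < \<epsilon>" if "N \<le> m" "m < n" for m n
      using tail[of m "n - m"] N[of m] that by (simp add: dist_real_def)
    then show "\<exists>N. \<forall>m\<ge>N. \<forall>n>m. dist (f m) (f n) < \<epsilon>" by blast
  qed
  then show lim: "f \<longlonglongrightarrow> lim f"
    by (simp add: Cauchy_convergent_iff convergent_LIMSEQ_iff)
  have "(\<lambda>j. \<bar>f (n + j) - f n\<bar>) \<longlonglongrightarrow> \<bar>lim f - f n\<bar>"
    using LIMSEQ_ignore_initial_segment[OF lim, of n]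
    by (intro tendsto_intros) (simp add: add.commute)
  then show "\<bar>lim f - f n\<bar> \<le> q ^ n * C"
    by (rule LIMSEQ_le_const2) (use tail in auto)
qed

locale stationary_model = coherent_risk_measure M p \<rho>
  for M :: "'w measure" and p :: real and \<rho> :: "('w \<Rightarrow> real) \<Rightarrow> ereal" +
  fixes E :: "'e::polish_space set" and A :: "'a::polish_space set" and D :: "('e \<times> 'a) set"
    and ZS :: "'z measure" and Z :: "'w \<Rightarrow> 'z" and T :: "'e \<Rightarrow> 'a \<Rightarrow> 'z \<Rightarrow> 'e"
    and c :: "'e \<Rightarrow> 'a \<Rightarrow> 'e \<Rightarrow> real" and \<beta> :: real
    and \<alpha> :: real and bl bu :: "'e \<Rightarrow> real"
  assumes D_subset: "D \<subseteq> E \<times> A"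
    and graph: "decision_rules E A D \<noteq> {}"
    and Z_measurable: "Z \<in> M \<rightarrow>\<^sub>M ZS"
    and T_measurable: "(\<lambda>((x, a), z). T x a z) \<in> restrict_space borel D \<Otimes>\<^sub>M ZS \<rightarrow>\<^sub>M restrict_space borel E"
    and \<beta>_pos: "0 < \<beta>"
    and values_measurable: "\<And>N \<pi>. \<pi> \<in> Markov_policies E A D \<Longrightarrow>
          policy_value \<rho> T Z c \<beta> N \<pi> \<in> borel_measurable (restrict_space borel E)"
    and D_usc: "usc_set_valued_on E D"
    and T_continuous: "\<And>z. z \<in> space ZS \<Longrightarrow> continuous_on D (\<lambda>(x, a). T x a z)"
    and c_lsc: "lsc_on (D \<times> E) (\<lambda>((x, a), y). c x a y)"
    and \<alpha>_nonneg: "0 \<le> \<alpha>"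
    and bl_measurable: "bl \<in> borel_measurable (restrict_space borel E)"
    and bl_nonpos: "\<And>x. x \<in> E \<Longrightarrow> bl x \<le> 0"
    and bu_measurable: "bu \<in> borel_measurable (restrict_space borel E)"
    and bu_nonneg: "\<And>x. x \<in> E \<Longrightarrow> 0 \<le> bu x"
    and lower_cost: "\<And>x a. (x, a) \<in> D \<Longrightarrow> \<rho> (\<lambda>w. c x a (T x a (Z w))) \<ge> ereal (bl x)"
    and lower_drift: "\<And>x a. (x, a) \<in> D \<Longrightarrow> \<rho> (\<lambda>w. - bl (T x a (Z w))) \<le> ereal (- \<alpha> * bl x)"
    and upper_cost: "\<And>x a. (x, a) \<in> D \<Longrightarrow> \<rho> (\<lambda>w. c x a (T x a (Z w))) \<le> ereal (bu x)"
    and upper_drift: "\<And>x a. (x, a) \<in> D \<Longrightarrow> \<rho> (\<lambda>w. bu (T x a (Z w))) \<le> ereal (\<alpha> * bu x)"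
    and local_bound: "\<And>x0 a0. (x0, a0) \<in> D \<Longrightarrow>
          \<exists>\<epsilon>>0. \<exists>\<Theta>1 \<Theta>2.
            \<Theta>1 \<in> borel_measurable ZS \<and> \<Theta>2 \<in> borel_measurable ZS \<and>
            (\<forall>z\<in>space ZS. 0 \<le> \<Theta>1 z \<and> 0 \<le> \<Theta>2 z) \<and>
            (\<lambda>w. \<Theta>1 (Z w)) \<in> Lp M p \<and> (\<lambda>w. \<Theta>2 (Z w)) \<in> Lp M p \<and>
            (\<forall>z\<in>space ZS. \<forall>(x, a)\<in>D \<inter> cball (x0, a0) \<epsilon>.
               \<bar>c x a (T x a z)\<bar> \<le> \<Theta>1 z \<and> bu (T x a z) - bl (T x a z) \<le> \<Theta>2 z)"
    and contraction: "\<alpha> * \<beta> < 1"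
begin

text \<open>K solves 1 + \<alpha> \<beta> K = K. One stage of cost bounded by \<open>bu\<close> plus
  the discounted drift of K * \<open>bu\<close> is then again bounded by K * \<open>bu\<close>, and
  likewise for \<open>bl\<close>, so the operators preserve the bounds.\<close>

definition K :: real where "K = 1 / (1 - \<alpha> * \<beta>)"

abbreviation b :: "'e \<Rightarrow> real" where "b x \<equiv> bu x - bl x"

abbreviation risk :: "('e \<Rightarrow> real) \<Rightarrow> 'e \<Rightarrow> 'a \<Rightarrow> ereal" where "risk \<equiv> stage_risk \<rho> T Z c \<beta>"

abbreviation Bellman :: "('e \<Rightarrow> real) \<Rightarrow> 'e \<Rightarrow> ereal" where "Bellman \<equiv> Bellman_operator \<rho> D T Z c \<beta>"

abbreviation pvalue :: "nat \<Rightarrow> (nat \<Rightarrow> 'e \<Rightarrow> 'a) \<Rightarrow> 'e \<Rightarrow> ereal" where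
  "pvalue \<equiv> policy_value \<rho> T Z c \<beta>"

text \<open>Semicontinuity is left out on purpose: the values of an arbitrary Markov policy have to
  belong to this class.\<close>

definition bounded_values :: "('e \<Rightarrow> real) set" where
  "bounded_values = {v \<in> borel_measurable (restrict_space borel E). \<forall>x\<in>E. K * bl x \<le> v x \<and> v x \<le> K * bu x}"

lemma modulus_nonneg: "0 \<le> \<alpha> * \<beta>"
  using \<alpha>_nonneg \<beta>_pos by simp

lemma K_pos: "0 < K"
  using contraction by (simp add: K_def)

lemma K_eq: "1 + \<beta> * K * \<alpha> = K"
  using contraction by (simp add: K_def field_simps)

lemma b_nonneg: "x \<in> E \<Longrightarrow> 0 \<le> b x"
  using bl_nonpos bu_nonneg by (meson diff_ge_0_iff_ge order_trans)

lemma bounded_values_abs_le: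
  assumes "v \<in> bounded_values" "x \<in> E"
  shows "\<bar>v x\<bar> \<le> K * b x"
proof -
  have "K * bl x \<le> 0" "0 \<le> K * bu x"
    using bl_nonpos bu_nonneg K_pos assms(2) by (auto simp: mult_nonneg_nonpos)
  moreover have "K * bl x \<le> v x" "v x \<le> K * bu x" using assms by (auto simp: bounded_values_def)
  ultimately show ?thesis by (auto simp: right_diff_distrib abs_le_iff)
qed

lemma zero_bounded_values: "(\<lambda>_. 0) \<in> bounded_values"
  using bl_nonpos bu_nonneg K_pos by (auto simp: bounded_values_def mult_nonneg_nonpos)

section \<open>Successor states and membership in L^p\<close>

lemma T_in:
  assumes "(x, a) \<in> D" "z \<in> space ZS"
  shows "T x a z \<in> E"
  using measurable_space[OF T_measurable, of "((x, a), z)"] assms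
  by (auto simp: space_pair_measure space_restrict_space)

lemma Z_space: "w \<in> space M \<Longrightarrow> Z w \<in> space ZS"
  by (rule measurable_space[OF Z_measurable])

lemma T_Z_in: "(x, a) \<in> D \<Longrightarrow> w \<in> space M \<Longrightarrow> T x a (Z w) \<in> E"
  by (intro T_in Z_space)

lemma T_Z_measurable:
  assumes "(x, a) \<in> D"
  shows "(\<lambda>w. T x a (Z w)) \<in> M \<rightarrow>\<^sub>M restrict_space borel E"
proof -
  have "(\<lambda>w. ((x, a), Z w)) \<in> M \<rightarrow>\<^sub>M restrict_space borel D \<Otimes>\<^sub>M ZS"
    using assms by (intro measurable_Pair measurable_const Z_measurable) (simp add: space_restrict_space)
  from measurable_compose[OF this T_measurable] show ?thesis by simp
qed

lemma next_measurable:
  "(x, a) \<in> D \<Longrightarrow> v \<in> borel_measurable (restrict_space borel E) \<Longrightarrow>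
    (\<lambda>w. v (T x a (Z w))) \<in> borel_measurable M"
  by (rule measurable_compose[OF T_Z_measurable])

text \<open>For a fixed pair (x, a), this supplies the Borel measurability of the cost in the
  successor state, and with it membership of the random cost in L^p.\<close>

lemma cost_slice_lsc:
  assumes "(x, a) \<in> D"
  shows "lsc_on E (c x a)"
proof (rule lsc_onI_sequentially)
  fix y ys t assume *: "y \<in> E" "\<And>n::nat. ys n \<in> E" "ys \<longlonglongrightarrow> y" "t < c x a y"
  have "\<forall>\<^sub>F n in sequentially. t < (\<lambda>((x, a), y). c x a y) ((x, a), ys n)"
    using * assms
    by (intro lsc_onD_sequentially[OF c_lsc, where x = "((x, a), y)" and xs = "\<lambda>n. ((x, a), ys n)"])
      (auto intro!: tendsto_intros)
  then show "\<exists>n. t < c x a (ys n)"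
    by (auto dest: eventually_happens)
qed

lemma local_boundE:
  assumes "(x0, a0) \<in> D"
  obtains \<epsilon> \<Theta>1 \<Theta>2 where "0 < \<epsilon>" "\<And>z. z \<in> space ZS \<Longrightarrow> 0 \<le> \<Theta>1 z" "\<And>z. z \<in> space ZS \<Longrightarrow> 0 \<le> \<Theta>2 z"
    "(\<lambda>w. \<Theta>1 (Z w)) \<in> Lp M p" "(\<lambda>w. \<Theta>2 (Z w)) \<in> Lp M p"
    "\<And>z x a. z \<in> space ZS \<Longrightarrow> (x, a) \<in> D \<Longrightarrow> (x, a) \<in> cball (x0, a0) \<epsilon> \<Longrightarrow>
      \<bar>c x a (T x a z)\<bar> \<le> \<Theta>1 z \<and> b (T x a z) \<le> \<Theta>2 z"
proof -
  from local_bound[OF assms] obtain \<epsilon> \<Theta>1 \<Theta>2 where *: "0 < \<epsilon>"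
    "\<forall>z\<in>space ZS. 0 \<le> \<Theta>1 z \<and> 0 \<le> \<Theta>2 z"
    "(\<lambda>w. \<Theta>1 (Z w)) \<in> Lp M p" "(\<lambda>w. \<Theta>2 (Z w)) \<in> Lp M p"
    "\<forall>z\<in>space ZS. \<forall>(x, a)\<in>D \<inter> cball (x0, a0) \<epsilon>. \<bar>c x a (T x a z)\<bar> \<le> \<Theta>1 z \<and> b (T x a z) \<le> \<Theta>2 z"
    by (elim exE conjE) rule
  have "\<bar>c x a (T x a z)\<bar> \<le> \<Theta>1 z \<and> b (T x a z) \<le> \<Theta>2 z"
    if "z \<in> space ZS" "(x, a) \<in> D" "(x, a) \<in> cball (x0, a0) \<epsilon>" for z x a
    using bspec[OF bspec[OF *(5) that(1)], of "(x, a)"] that(2,3) by simp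
  then show ?thesis using * by (intro that[of \<epsilon> \<Theta>1 \<Theta>2]) simp_all
qed

lemma cost_Lp:
  assumes "(x, a) \<in> D"
  shows "(\<lambda>w. c x a (T x a (Z w))) \<in> Lp M p"
proof -
  obtain \<epsilon> \<Theta>1 \<Theta>2 where \<Theta>: "0 < \<epsilon>" "(\<lambda>w. \<Theta>1 (Z w)) \<in> Lp M p"
    "\<And>z x' a'. z \<in> space ZS \<Longrightarrow> (x', a') \<in> D \<Longrightarrow> (x', a') \<in> cball (x, a) \<epsilon> \<Longrightarrow>
      \<bar>c x' a' (T x' a' z)\<bar> \<le> \<Theta>1 z \<and> b (T x' a' z) \<le> \<Theta>2 z"
    by (rule local_boundE[OF assms]) blast
  show ?thesis
    by (rule Lp_dominated[OF p_nonneg \<Theta>(2) next_measurable[OF assms lsc_on_measurable[OF cost_slice_lsc[OF assms]]]])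
      (use \<Theta>(1,3) assms Z_space in auto)
qed

lemma b_next_Lp:
  assumes "(x, a) \<in> D"
  shows "(\<lambda>w. b (T x a (Z w))) \<in> Lp M p"
proof -
  obtain \<epsilon> \<Theta>1 \<Theta>2 where \<Theta>: "0 < \<epsilon>" "(\<lambda>w. \<Theta>2 (Z w)) \<in> Lp M p"
    "\<And>z x' a'. z \<in> space ZS \<Longrightarrow> (x', a') \<in> D \<Longrightarrow> (x', a') \<in> cball (x, a) \<epsilon> \<Longrightarrow>
      \<bar>c x' a' (T x' a' z)\<bar> \<le> \<Theta>1 z \<and> b (T x' a' z) \<le> \<Theta>2 z"
    by (rule local_boundE[OF assms]) blast
  show ?thesis
  proof (rule Lp_dominated[OF p_nonneg \<Theta>(2)])
    show "(\<lambda>w. b (T x a (Z w))) \<in> borel_measurable M"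
      by (intro borel_measurable_diff next_measurable[OF assms] bl_measurable bu_measurable)
    show "\<bar>b (T x a (Z w))\<bar> \<le> \<Theta>2 (Z w)" if "w \<in> space M" for w
      using \<Theta>(1) \<Theta>(3)[OF Z_space[OF that] assms] b_nonneg[OF T_Z_in[OF assms that]] by simp
  qed
qed

lemma next_Lp:
  assumes D: "(x, a) \<in> D" and v: "v \<in> borel_measurable (restrict_space borel E)"
    and le: "\<And>y. y \<in> E \<Longrightarrow> \<bar>v y\<bar> \<le> l * b y"
  shows "(\<lambda>w. v (T x a (Z w))) \<in> Lp M p"
  by (rule Lp_dominated[OF p_nonneg Lp_cmult[OF b_next_Lp[OF D], of l] next_measurable[OF D v]])
    (use le T_Z_in[OF D] in auto)

lemma stage_Lp:
  assumes D: "(x, a) \<in> D" and v: "v \<in> bounded_values"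
  shows "(\<lambda>w. c x a (T x a (Z w)) + \<beta> * v (T x a (Z w))) \<in> Lp M p"
  by (intro Lp_add[OF p_nonneg cost_Lp[OF D]] Lp_cmult next_Lp[OF D, of _ K] bounded_values_abs_le v)
    (use v in \<open>auto simp: bounded_values_def\<close>)

lemma bu_next_Lp: "(x, a) \<in> D \<Longrightarrow> (\<lambda>w. bu (T x a (Z w))) \<in> Lp M p"
  by (rule next_Lp[where l = 1]) (auto simp: bu_measurable bl_nonpos bu_nonneg)

lemma bl_next_Lp: "(x, a) \<in> D \<Longrightarrow> (\<lambda>w. - bl (T x a (Z w))) \<in> Lp M p"
  by (rule next_Lp[where l = 1]) (auto simp: bl_measurable bl_nonpos bu_nonneg)

section \<open>Bounds and weighted contraction for the stage risk\<close>

lemma b_drift: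
  assumes "(x, a) \<in> D"
  shows "\<rho> (\<lambda>w. b (T x a (Z w))) \<le> ereal (\<alpha> * b x)"
proof -
  have "\<rho> (\<lambda>w. b (T x a (Z w))) \<le> \<rho> (\<lambda>w. bu (T x a (Z w))) + \<rho> (\<lambda>w. - bl (T x a (Z w)))"
    using risk_add[OF bu_next_Lp[OF assms] bl_next_Lp[OF assms]] by simp
  also have "\<dots> \<le> ereal (\<alpha> * bu x) + ereal (- \<alpha> * bl x)"
    by (intro add_mono upper_drift lower_drift assms)
  finally show ?thesis by (simp add: algebra_simps)
qed

lemma risk_upper:
  assumes D: "(x, a) \<in> D" and v: "v \<in> bounded_values"
  shows "risk v x a \<le> ereal (K * bu x)"
proof -
  have "risk v x a \<le> \<rho> (\<lambda>w. c x a (T x a (Z w))) + ereal (\<beta> * K * (\<alpha> * bu x))"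
    unfolding stage_risk_def
  proof (rule risk_le_add_mult[OF stage_Lp[OF D v] cost_Lp[OF D] bu_next_Lp[OF D] _ _ upper_drift[OF D]])
    show "c x a (T x a (Z w)) + \<beta> * v (T x a (Z w)) \<le> c x a (T x a (Z w)) + \<beta> * K * bu (T x a (Z w))"
      if "w \<in> space M" for w
      using v T_Z_in[OF D that] \<beta>_pos by (auto simp: bounded_values_def)
  qed (use \<beta>_pos K_pos in simp)
  also have "\<dots> \<le> ereal (bu x) + ereal (\<beta> * K * (\<alpha> * bu x))"
    by (intro add_mono upper_cost D order_refl)
  also have "\<dots> = ereal ((1 + \<beta> * K * \<alpha>) * bu x)" by (simp add: algebra_simps)
  finally show ?thesis unfolding K_eq .
qed

text \<open>Subadditivity gives no direct lower bound for a sum. Instead the cost alone is dominated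
  by cost + \<beta> v plus \<beta> K (- bl), and the resulting inequality is solved for the stage
  risk; hence the lower drift condition concerns \<open>- bl\<close>.\<close>

lemma risk_lower:
  assumes D: "(x, a) \<in> D" and v: "v \<in> bounded_values"
  shows "ereal (K * bl x) \<le> risk v x a"
proof -
  have "ereal (bl x) \<le> \<rho> (\<lambda>w. c x a (T x a (Z w)))" by (rule lower_cost[OF D])
  also have "\<dots> \<le> risk v x a + ereal (\<beta> * K * (- \<alpha> * bl x))"
    unfolding stage_risk_def
  proof (rule risk_le_add_mult[OF cost_Lp[OF D] stage_Lp[OF D v] bl_next_Lp[OF D] _ _ lower_drift[OF D]])
    fix w assume w: "w \<in> space M"
    have "\<beta> * (K * bl (T x a (Z w))) \<le> \<beta> * v (T x a (Z w))"
      using v T_Z_in[OF D w] \<beta>_pos by (auto simp: bounded_values_def)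
    then show "c x a (T x a (Z w)) \<le> c x a (T x a (Z w)) + \<beta> * v (T x a (Z w)) + \<beta> * K * - bl (T x a (Z w))"
      by simp
  qed (use \<beta>_pos K_pos in simp)
  finally have "ereal (bl x - \<beta> * K * (- \<alpha> * bl x)) \<le> risk v x a"
    by (cases "risk v x a") auto
  moreover have "bl x - \<beta> * K * (- \<alpha> * bl x) = (1 + \<beta> * K * \<alpha>) * bl x" by (simp add: algebra_simps)
  ultimately show ?thesis unfolding K_eq by simp
qed

definition rrisk :: "('e \<Rightarrow> real) \<Rightarrow> 'e \<Rightarrow> 'a \<Rightarrow> real" where
  "rrisk v x a = real_of_ereal (risk v x a)"

lemma ereal_rrisk: "(x, a) \<in> D \<Longrightarrow> v \<in> bounded_values \<Longrightarrow> risk v x a = ereal (rrisk v x a)"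
  using risk_lower[of x a v] risk_upper[of x a v] unfolding rrisk_def by (cases "risk v x a") auto

lemma rrisk_bounds:
  assumes "(x, a) \<in> D" "v \<in> bounded_values"
  shows "K * bl x \<le> rrisk v x a" "rrisk v x a \<le> K * bu x"
  using risk_lower[OF assms] risk_upper[OF assms] ereal_rrisk[OF assms] by auto

text \<open>The source of the contraction: subadditivity separates the excess \<beta> l b at the
  successor state, and the drift of b replaces it by \<alpha> \<beta> l b at the current state. The
  one-sided form passes directly to infima over actions.\<close>

lemma rrisk_le:
  assumes D: "(x, a) \<in> D" and u: "u \<in> bounded_values" and v: "v \<in> bounded_values" and l: "0 \<le> l"
    and le: "\<And>y. y \<in> E \<Longrightarrow> v y \<le> u y + l * b y"
  shows "rrisk v x a \<le> rrisk u x a + \<alpha> * \<beta> * (l * b x)"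
proof -
  have "risk v x a \<le> risk u x a + ereal (\<beta> * l * (\<alpha> * b x))"
    unfolding stage_risk_def
  proof (rule risk_le_add_mult[OF stage_Lp[OF D v] stage_Lp[OF D u] b_next_Lp[OF D] _ _ b_drift[OF D]])
    fix w assume w: "w \<in> space M"
    have "\<beta> * v (T x a (Z w)) \<le> \<beta> * (u (T x a (Z w)) + l * b (T x a (Z w)))"
      using le[OF T_Z_in[OF D w]] \<beta>_pos by simp
    then show "c x a (T x a (Z w)) + \<beta> * v (T x a (Z w))
      \<le> c x a (T x a (Z w)) + \<beta> * u (T x a (Z w)) + \<beta> * l * b (T x a (Z w))"
      by (simp add: algebra_simps)
  qed (use \<beta>_pos l in simp)
  then show ?thesis unfolding ereal_rrisk[OF D u] ereal_rrisk[OF D v] by (simp add: algebra_simps)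
qed

lemma rrisk_mono:
  assumes "(x, a) \<in> D" "u \<in> bounded_values" "v \<in> bounded_values" "\<And>y. y \<in> E \<Longrightarrow> v y \<le> u y"
  shows "rrisk v x a \<le> rrisk u x a"
  using rrisk_le[of x a u v 0] assms by simp

lemma rrisk_lipschitz:
  assumes D: "(x, a) \<in> D" and u: "u \<in> bounded_values" and v: "v \<in> bounded_values" and l: "0 \<le> l"
    and le: "\<And>y. y \<in> E \<Longrightarrow> \<bar>v y - u y\<bar> \<le> l * b y"
  shows "\<bar>rrisk v x a - rrisk u x a\<bar> \<le> \<alpha> * \<beta> * (l * b x)"
proof -
  have "v y \<le> u y + l * b y" "u y \<le> v y + l * b y" if "y \<in> E" for y using le[OF that] by auto
  from rrisk_le[OF D u v l this(1)] rrisk_le[OF D v u l this(2)] show ?thesis by simp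
qed

section \<open>Semicontinuity of the stage risk\<close>

text \<open>Unlike lower semicontinuity on \<open>E\<close>, this property passes to limits that are uniform relative to \<open>b\<close>.\<close>

definition admissible :: "('e \<Rightarrow> real) set" where
  "admissible = {v \<in> bounded_values. \<forall>B. lsc_on {y\<in>E. b y \<le> B} v}"

lemma admissible_bounded: "v \<in> admissible \<Longrightarrow> v \<in> bounded_values"
  by (simp add: admissible_def)

lemma lsc_admissible:
  assumes "lsc_on E v" "\<And>x. x \<in> E \<Longrightarrow> K * bl x \<le> v x" "\<And>x. x \<in> E \<Longrightarrow> v x \<le> K * bu x"
  shows "v \<in> admissible"
  using assms lsc_on_measurable[OF assms(1)]
  by (auto simp: admissible_def bounded_values_def intro: lsc_on_subset)

lemma zero_admissible: "(\<lambda>_. 0) \<in> admissible"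
  using zero_bounded_values by (auto simp: admissible_def lsc_on_def)

lemma stage_risk_lsc:
  assumes v: "v \<in> admissible" and D: "(x, a) \<in> D" and ps: "\<And>k::nat. (xs k, as k) \<in> D"
    and lim: "xs \<longlonglongrightarrow> x" "as \<longlonglongrightarrow> a"
  shows "risk v x a \<le> liminf (\<lambda>k. risk v (xs k) (as k))"
proof -
  note vb = admissible_bounded[OF v]
  obtain \<epsilon> \<Theta>1 \<Theta>2 where \<epsilon>: "0 < \<epsilon>" and \<Theta>_Lp: "(\<lambda>w. \<Theta>1 (Z w)) \<in> Lp M p" "(\<lambda>w. \<Theta>2 (Z w)) \<in> Lp M p"
    and \<Theta>: "\<And>z x' a'. z \<in> space ZS \<Longrightarrow> (x', a') \<in> D \<Longrightarrow> (x', a') \<in> cball (x, a) \<epsilon> \<Longrightarrow>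
      \<bar>c x' a' (T x' a' z)\<bar> \<le> \<Theta>1 z \<and> b (T x' a' z) \<le> \<Theta>2 z"
    by (rule local_boundE[OF D]) blast
  have plim: "(\<lambda>k. (xs k, as k)) \<longlonglongrightarrow> (x, a)" by (rule tendsto_Pair[OF lim])
  have "\<forall>\<^sub>F k in sequentially. (xs k, as k) \<in> ball (x, a) \<epsilon>"
    by (rule topological_tendstoD[OF plim]) (use \<epsilon> in auto)
  \<comment> \<open>Domination by \<Theta>1 and \<Theta>2 holds only in the ball, but is required
    for all indices. An initial segment is therefore dropped, which leaves the limit inferior
    unchanged.\<close>
  then obtain N where N: "\<And>k. (xs (k + N), as (k + N)) \<in> cball (x, a) \<epsilon>"
    unfolding eventually_sequentially by (metis ball_subset_cball le_add2 subsetD)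
  define X where "X x a w = c x a (T x a (Z w)) + \<beta> * v (T x a (Z w))" for x a w
  have risk_eq: "risk v x a = \<rho> (X x a)" for x a by (simp add: stage_risk_def X_def[abs_def])
  have "\<rho> (X x a) \<le> liminf (\<lambda>k. \<rho> (X (xs (k + N)) (as (k + N))))"
  proof (rule risk_le_liminf)
    show "X x a \<in> Lp M p" unfolding X_def by (rule stage_Lp[OF D vb])
    \<comment> \<open>The second summand dominates the continuation value, as |v| <= K b and b is at
      most \<Theta>2 at the successor states.\<close>
    show "(\<lambda>w. \<Theta>1 (Z w) + \<beta> * K * \<Theta>2 (Z w)) \<in> Lp M p"
      by (intro Lp_add[OF p_nonneg] Lp_cmult \<Theta>_Lp)
    show "X (xs (n + N)) (as (n + N)) \<in> Lp M p" for n unfolding X_def by (rule stage_Lp[OF ps vb])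
  next
    fix n w assume w: "w \<in> space M"
    let ?y = "T (xs (n + N)) (as (n + N)) (Z w)"
    have "\<bar>c (xs (n + N)) (as (n + N)) ?y\<bar> \<le> \<Theta>1 (Z w)" and b: "b ?y \<le> \<Theta>2 (Z w)"
      using \<Theta>[OF Z_space[OF w] ps N] by auto
    moreover have "\<bar>\<beta> * v ?y\<bar> \<le> \<beta> * K * \<Theta>2 (Z w)"
    proof -
      have "\<bar>v ?y\<bar> \<le> K * b ?y" by (rule bounded_values_abs_le[OF vb T_Z_in[OF ps w]])
      also have "\<dots> \<le> K * \<Theta>2 (Z w)" using b K_pos by simp
      finally show ?thesis using \<beta>_pos by (simp add: abs_mult)
    qed
    ultimately show "\<bar>X (xs (n + N)) (as (n + N)) w\<bar> \<le> \<Theta>1 (Z w) + \<beta> * K * \<Theta>2 (Z w)"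
      unfolding X_def by linarith
  next
    fix w t assume w: "w \<in> space M" and t: "t < X x a w"
    let ?y = "T x a (Z w)" and ?ys = "\<lambda>n. T (xs (n + N)) (as (n + N)) (Z w)"
    have "(\<lambda>n. (case (xs n, as n) of (x, a) \<Rightarrow> T x a (Z w))) \<longlonglongrightarrow> (case (x, a) of (x, a) \<Rightarrow> T x a (Z w))"
      by (rule continuous_on_tendsto_compose[OF T_continuous[OF Z_space[OF w]] plim D]) (use ps in auto)
    then have ylim: "?ys \<longlonglongrightarrow> ?y"
      using LIMSEQ_ignore_initial_segment[of _ ?y N] by simp
    \<comment> \<open>The gap between t and the limit position is shared: \<delta> may be lost in
      the cost and \<delta> in v, where the latter counts with weight \<beta>.\<close>
    define \<delta> where "\<delta> = (X x a w - t) / (1 + \<beta>)"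
    have "\<delta> * (1 + \<beta>) = X x a w - t"
      using \<beta>_pos by (simp add: \<delta>_def)
    then have \<delta>: "t = c x a ?y + \<beta> * v ?y - (\<delta> + \<beta> * \<delta>)" "0 < \<delta>"
      using t \<beta>_pos by (simp add: X_def algebra_simps, simp add: \<delta>_def)
    have "\<forall>\<^sub>F n in sequentially. v ?y - \<delta> < v (?ys n)"
    \<comment> \<open>For fixed w the bound \<Theta>2 (Z w) does not depend on n, so the successor
      states and their limit lie in one sublevel set of b, where v is lower semicontinuous.\<close>
    proof (rule lsc_onD_sequentially[where f = v and xs = "?ys"])
      show "lsc_on {y\<in>E. b y \<le> \<Theta>2 (Z w)} v" using v by (simp add: admissible_def)
      show "?y \<in> {y\<in>E. b y \<le> \<Theta>2 (Z w)}"
        using T_Z_in[OF D w] \<Theta>[OF Z_space[OF w] D] \<epsilon> by auto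
      show "?ys n \<in> {y\<in>E. b y \<le> \<Theta>2 (Z w)}" for n
        using T_Z_in[OF ps w] \<Theta>[OF Z_space[OF w] ps N] by auto
    qed (use ylim \<delta> in auto)
    moreover have "\<forall>\<^sub>F n in sequentially. c x a ?y - \<delta> <
      (\<lambda>((x, a), y). c x a y) ((xs (n + N), as (n + N)), ?ys n)"
    proof (rule lsc_onD_sequentially[OF c_lsc, where xs = "\<lambda>n. ((xs (n + N), as (n + N)), ?ys n)"])
      show "(\<lambda>n. ((xs (n + N), as (n + N)), ?ys n)) \<longlonglongrightarrow> ((x, a), ?y)"
        by (intro tendsto_Pair LIMSEQ_ignore_initial_segment lim ylim)
    qed (use D ps T_Z_in[OF D w] T_Z_in[OF ps w] \<delta> in auto)
    ultimately show "\<forall>\<^sub>F n in sequentially. t < X (xs (n + N)) (as (n + N)) w"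
    proof eventually_elim
      case (elim n)
      have "\<beta> * (v ?y - \<delta>) < \<beta> * v (?ys n)" using elim(1) \<beta>_pos by simp
      then show ?case using elim(2) unfolding \<delta>(1) X_def by (simp add: algebra_simps)
    qed
  qed
  also have "\<dots> = liminf (\<lambda>k. \<rho> (X (xs k) (as k)))"
    by (rule liminf_shift_k)
  finally show ?thesis unfolding risk_eq .
qed

lemma D_nonempty: "x \<in> E \<Longrightarrow> D `` {x} \<noteq> {}"
  using graph unfolding decision_rules_def by blast

lemma parametric_minimization:
  assumes "v \<in> admissible"
  shows "parametric_minimization E D (risk v)"
  by standard (use assms D_usc D_nonempty stage_risk_lsc in auto)

section \<open>The Bellman operator and its minimizers\<close>

definition rBellman :: "('e \<Rightarrow> real) \<Rightarrow> 'e \<Rightarrow> real" where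
  "rBellman v x = real_of_ereal (Bellman v x)"

lemma Bellman_bounds:
  assumes v: "v \<in> bounded_values" and x: "x \<in> E"
  shows "Bellman v x = ereal (rBellman v x)" "K * bl x \<le> rBellman v x" "rBellman v x \<le> K * bu x"
proof -
  obtain a where a: "(x, a) \<in> D" using D_nonempty[OF x] by auto
  have "Bellman v x \<le> risk v x a" unfolding Bellman_operator_def using a by (auto intro: INF_lower)
  then have u: "Bellman v x \<le> ereal (K * bu x)" using risk_upper[OF a v] by (rule order_trans)
  have l: "ereal (K * bl x) \<le> Bellman v x"
    unfolding Bellman_operator_def by (rule INF_greatest) (use risk_lower v in auto)
  show eq: "Bellman v x = ereal (rBellman v x)"
    using u l unfolding rBellman_def by (cases "Bellman v x") auto
  show "K * bl x \<le> rBellman v x" "rBellman v x \<le> K * bu x" using u l unfolding eq by auto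
qed

lemma rBellman_le_rrisk:
  assumes "v \<in> bounded_values" "(x, a) \<in> D"
  shows "rBellman v x \<le> rrisk v x a"
proof -
  have "x \<in> E" using assms D_subset by auto
  have "Bellman v x \<le> risk v x a" unfolding Bellman_operator_def using assms by (auto intro: INF_lower)
  then show ?thesis unfolding Bellman_bounds(1)[OF assms(1) \<open>x \<in> E\<close>] ereal_rrisk[OF assms(2,1)] by simp
qed

lemma rBellman_greatest:
  assumes v: "v \<in> bounded_values" and x: "x \<in> E" and "\<And>a. (x, a) \<in> D \<Longrightarrow> r \<le> rrisk v x a"
  shows "r \<le> rBellman v x"
proof -
  have "ereal r \<le> Bellman v x"
    unfolding Bellman_operator_def by (rule INF_greatest) (use assms ereal_rrisk in auto)
  then show ?thesis unfolding Bellman_bounds(1)[OF v x] by simp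
qed

lemma rBellman_le:
  assumes u: "u \<in> bounded_values" and v: "v \<in> bounded_values" and l: "0 \<le> l"
    and le: "\<And>y. y \<in> E \<Longrightarrow> v y \<le> u y + l * b y" and x: "x \<in> E"
  shows "rBellman v x \<le> rBellman u x + \<alpha> * \<beta> * (l * b x)"
proof -
  have "rBellman v x - \<alpha> * \<beta> * (l * b x) \<le> rBellman u x"
  proof (rule rBellman_greatest[OF u x])
    fix a assume a: "(x, a) \<in> D"
    show "rBellman v x - \<alpha> * \<beta> * (l * b x) \<le> rrisk u x a"
      using rBellman_le_rrisk[OF v a] rrisk_le[OF a u v l le] by simp
  qed
  then show ?thesis by simp
qed

lemma rBellman_lipschitz:
  assumes u: "u \<in> bounded_values" and v: "v \<in> bounded_values" and l: "0 \<le> l"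
    and le: "\<And>y. y \<in> E \<Longrightarrow> \<bar>v y - u y\<bar> \<le> l * b y" and x: "x \<in> E"
  shows "\<bar>rBellman v x - rBellman u x\<bar> \<le> \<alpha> * \<beta> * (l * b x)"
proof -
  have "v y \<le> u y + l * b y" "u y \<le> v y + l * b y" if "y \<in> E" for y using le[OF that] by auto
  from rBellman_le[OF u v l this(1) x] rBellman_le[OF v u l this(2) x] show ?thesis by simp
qed

text \<open>The conclusion is stronger than what is assumed of v: semicontinuity on sublevel sets of
  b becomes semicontinuity on all of E. This gain is what a fixed point inherits.\<close>

lemma rBellman_lsc:
  assumes v: "v \<in> admissible"
  shows "lsc_on E (rBellman v)"
proof (rule lsc_onI_closedin)
  interpret parametric_minimization E D "risk v" by (rule parametric_minimization[OF v])
  fix t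
  have "{x\<in>E. rBellman v x \<le> t} = {x\<in>E. min_over UNIV x \<le> ereal t}"
    using Bellman_bounds(1)[OF admissible_bounded[OF v]]
    by (auto simp: min_over_def Bellman_operator_def)
  then show "closedin (top_of_set E) {x\<in>E. rBellman v x \<le> t}"
    using closedin_min_over_le by simp
qed

lemma rBellman_admissible: "v \<in> admissible \<Longrightarrow> rBellman v \<in> admissible"
  by (rule lsc_admissible[OF rBellman_lsc Bellman_bounds(2) Bellman_bounds(3)]) (auto intro: admissible_bounded)

lemma minimizer:
  assumes v: "v \<in> admissible"
  obtains d where "d \<in> decision_rules E A D" "\<And>x. x \<in> E \<Longrightarrow> risk v x (d x) = Bellman v x"
proof -
  interpret parametric_minimization E D "risk v" by (rule parametric_minimization[OF v])
  obtain d where d: "d \<in> restrict_space borel E \<rightarrow>\<^sub>M borel"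
    "\<And>x. x \<in> E \<Longrightarrow> d x \<in> D `` {x} \<and> risk v x (d x) = min_over UNIV x"
    by (rule measurable_minimizer) blast
  have "d x \<in> A" if "x \<in> E" for x using d(2)[OF that] D_subset by auto
  then have "d \<in> decision_rules E A D"
    unfolding decision_rules_def using d
    by (auto intro!: measurable_restrict_space2 simp: space_restrict_space)
  then show ?thesis using d that by (auto simp: min_over_def Bellman_operator_def)
qed

lemma decision_rule_in: "d \<in> decision_rules E A D \<Longrightarrow> x \<in> E \<Longrightarrow> (x, d x) \<in> D"
  by (auto simp: decision_rules_def)

section \<open>Values of Markov policies\<close>

definition rvalue :: "nat \<Rightarrow> (nat \<Rightarrow> 'e \<Rightarrow> 'a) \<Rightarrow> 'e \<Rightarrow> real" where
  "rvalue N \<pi> x = real_of_ereal (pvalue N \<pi> x)"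

lemma rvalue_0: "rvalue 0 \<pi> = (\<lambda>_. 0)"
  by (simp add: rvalue_def fun_eq_iff)

lemma rvalue_Suc: "rvalue (Suc N) \<pi> x = rrisk (rvalue N (\<lambda>n. \<pi> (Suc n))) x (\<pi> 0 x)"
  by (simp add: rvalue_def[abs_def] rrisk_def rule_operator_def)

lemma Markov_policies_Suc: "\<pi> \<in> Markov_policies E A D \<Longrightarrow> (\<lambda>n. \<pi> (Suc n)) \<in> Markov_policies E A D"
  by (simp add: Markov_policies_def)

lemma Markov_policies_in: "\<pi> \<in> Markov_policies E A D \<Longrightarrow> x \<in> E \<Longrightarrow> (x, \<pi> n x) \<in> D"
  by (simp add: Markov_policies_def decision_rule_in)

lemma rvalue_bounded: "\<pi> \<in> Markov_policies E A D \<Longrightarrow> rvalue N \<pi> \<in> bounded_values"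
proof (induction N arbitrary: \<pi>)
  case 0
  then show ?case using zero_bounded_values by (simp add: rvalue_0)
next
  case (Suc N)
  have "rvalue (Suc N) \<pi> \<in> borel_measurable (restrict_space borel E)"
    unfolding rvalue_def[abs_def] by (intro borel_measurable_real_of_ereal values_measurable Suc.prems)
  moreover have "K * bl x \<le> rvalue (Suc N) \<pi> x \<and> rvalue (Suc N) \<pi> x \<le> K * bu x" if "x \<in> E" for x
    unfolding rvalue_Suc
    using rrisk_bounds[OF Markov_policies_in[OF Suc.prems that] Suc.IH[OF Markov_policies_Suc[OF Suc.prems]]] by simp
  ultimately show ?case by (simp add: bounded_values_def)
qed

lemma pvalue_eq:
  assumes \<pi>: "\<pi> \<in> Markov_policies E A D" and x: "x \<in> E"
  shows "pvalue N \<pi> x = ereal (rvalue N \<pi> x)"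
proof (cases N)
  case 0
  then show ?thesis by (simp add: rvalue_0)
next
  case (Suc n)
  have "pvalue (Suc n) \<pi> x = risk (rvalue n (\<lambda>n. \<pi> (Suc n))) x (\<pi> 0 x)"
    by (simp add: rule_operator_def rvalue_def[abs_def])
  then show ?thesis unfolding Suc rvalue_Suc
    by (simp add: ereal_rrisk[OF Markov_policies_in[OF \<pi> x] rvalue_bounded[OF Markov_policies_Suc[OF \<pi>]]])
qed

text \<open>Both values apply the same first n rules, one to the j-stage value of the shifted policy
  and the other to 0. These differ by at most K b, and each rule contracts the difference by
  \<alpha> \<beta>.\<close>

lemma rvalue_tail:
  "\<pi> \<in> Markov_policies E A D \<Longrightarrow> x \<in> E \<Longrightarrow>
    \<bar>rvalue (n + j) \<pi> x - rvalue n \<pi> x\<bar> \<le> (\<alpha> * \<beta>) ^ n * (K * b x)"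
proof (induction n arbitrary: \<pi> x)
  case 0
  then show ?case using bounded_values_abs_le[OF rvalue_bounded] by (simp add: rvalue_0)
next
  case (Suc n)
  note \<pi>' = Markov_policies_Suc[OF Suc.prems(1)]
  have "\<bar>rvalue (n + j) (\<lambda>n. \<pi> (Suc n)) y - rvalue n (\<lambda>n. \<pi> (Suc n)) y\<bar> \<le> (\<alpha> * \<beta>) ^ n * K * b y"
    if "y \<in> E" for y
    using Suc.IH[OF \<pi>' that] by (simp add: mult.assoc)
  from rrisk_lipschitz[OF Markov_policies_in[OF Suc.prems] rvalue_bounded[OF \<pi>'] rvalue_bounded[OF \<pi>'] _ this]
  show ?case using modulus_nonneg K_pos by (simp add: rvalue_Suc mult.assoc)
qed

lemma rvalue_limit:
  assumes "\<pi> \<in> Markov_policies E A D" "x \<in> E"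
  shows "(\<lambda>N. rvalue N \<pi> x) \<longlonglongrightarrow> lim (\<lambda>N. rvalue N \<pi> x)"
  by (rule geometric_tail_limit[OF rvalue_tail[OF assms] modulus_nonneg contraction])

section \<open>Value iteration and finite horizons\<close>

definition iterate :: "nat \<Rightarrow> 'e \<Rightarrow> real" where
  "iterate n = (rBellman ^^ n) (\<lambda>_. 0)"

lemma iterate_Suc: "iterate (Suc n) = rBellman (iterate n)"
  by (simp add: iterate_def)

lemma iterate_admissible: "iterate n \<in> admissible"
  by (induction n) (auto simp: iterate_def zero_admissible rBellman_admissible)

lemmas iterate_bounded = admissible_bounded[OF iterate_admissible]

lemma iterate_tail:
  "x \<in> E \<Longrightarrow> \<bar>iterate (n + j) x - iterate n x\<bar> \<le> (\<alpha> * \<beta>) ^ n * (K * b x)"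
proof (induction n arbitrary: x)
  case 0
  then show ?case using bounded_values_abs_le[OF iterate_bounded, of x j] by (simp add: iterate_def[of 0])
next
  case (Suc n)
  have "\<bar>iterate (n + j) y - iterate n y\<bar> \<le> (\<alpha> * \<beta>) ^ n * K * b y" if "y \<in> E" for y
    using Suc.IH[OF that] by (simp add: mult.assoc)
  from rBellman_lipschitz[OF iterate_bounded iterate_bounded _ this Suc.prems]
  show ?case using modulus_nonneg K_pos by (simp add: iterate_Suc mult.assoc)
qed

lemma iterate_le_rvalue:
  "\<pi> \<in> Markov_policies E A D \<Longrightarrow> x \<in> E \<Longrightarrow> iterate n x \<le> rvalue n \<pi> x"
proof (induction n arbitrary: \<pi> x)
  case 0
  then show ?case by (simp add: rvalue_0 iterate_def)
next
  case (Suc n)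
  note \<pi>' = Markov_policies_Suc[OF Suc.prems(1)] and D = Markov_policies_in[OF Suc.prems, of 0]
  have "iterate (Suc n) x \<le> rrisk (iterate n) x (\<pi> 0 x)"
    unfolding iterate_Suc by (rule rBellman_le_rrisk[OF iterate_bounded D])
  also have "\<dots> \<le> rvalue (Suc n) \<pi> x"
    unfolding rvalue_Suc by (rule rrisk_mono[OF D rvalue_bounded[OF \<pi>'] iterate_bounded Suc.IH[OF \<pi>']])
  finally show ?case .
qed

text \<open>Backward induction: a minimizer for \<open>iterate n\<close> is put in front of a policy
  that is optimal for n stages. The policy so obtained depends on the horizon.\<close>

lemma iterate_attained:
  "\<exists>\<pi>\<in>Markov_policies E A D. \<forall>x\<in>E. rvalue n \<pi> x = iterate n x"
proof (induction n)
  case 0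
  obtain d where "d \<in> decision_rules E A D" using graph by auto
  then show ?case by (intro bexI[of _ "\<lambda>_. d"]) (auto simp: rvalue_0 iterate_def Markov_policies_def)
next
  case (Suc n)
  then obtain \<pi> where \<pi>: "\<pi> \<in> Markov_policies E A D" "\<And>x. x \<in> E \<Longrightarrow> rvalue n \<pi> x = iterate n x" by blast
  obtain d where d: "d \<in> decision_rules E A D" "\<And>x. x \<in> E \<Longrightarrow> risk (iterate n) x (d x) = Bellman (iterate n) x"
    using minimizer[OF iterate_admissible] by metis
  have "rvalue (Suc n) (case_nat d \<pi>) x = iterate (Suc n) x" if x: "x \<in> E" for x
  proof -
    have "rvalue (Suc n) (case_nat d \<pi>) x = rrisk (rvalue n \<pi>) x (d x)"
      by (simp add: rvalue_Suc)
    \<comment> \<open>The two continuation values agree only on E, so they are exchanged by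
      monotonicity in both directions.\<close>
    also have "\<dots> = rrisk (iterate n) x (d x)"
      using \<pi> by (intro antisym rrisk_mono decision_rule_in d(1) x rvalue_bounded iterate_bounded) auto
    finally show ?thesis using d(2)[OF x] by (simp add: iterate_Suc rrisk_def rBellman_def)
  qed
  moreover have "case_nat d \<pi> \<in> Markov_policies E A D"
    using d \<pi> by (auto simp: Markov_policies_def split: nat.split)
  ultimately show ?case by blast
qed

lemma horizon_value_eq:
  assumes x: "x \<in> E"
  shows "horizon_value \<rho> E A D T Z c \<beta> N x = ereal (iterate N x)"
  unfolding horizon_value_def
proof (rule antisym)
  obtain \<pi> where "\<pi> \<in> Markov_policies E A D" "rvalue N \<pi> x = iterate N x"
    using iterate_attained x by blast
  then show "(INF \<pi>\<in>Markov_policies E A D. pvalue N \<pi> x) \<le> ereal (iterate N x)"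
    using pvalue_eq[OF _ x] by (metis INF_lower)
  show "ereal (iterate N x) \<le> (INF \<pi>\<in>Markov_policies E A D. pvalue N \<pi> x)"
    by (rule INF_greatest) (use pvalue_eq[OF _ x] iterate_le_rvalue[OF _ x] in auto)
qed

section \<open>The limit value function and the fixed point equation\<close>

definition J :: "'e \<Rightarrow> real" where
  "J x = lim (\<lambda>n. iterate n x)"

lemma iterate_limit:
  assumes "x \<in> E"
  shows "(\<lambda>n. iterate n x) \<longlonglongrightarrow> J x" "\<bar>J x - iterate n x\<bar> \<le> (\<alpha> * \<beta>) ^ n * (K * b x)"
  unfolding J_def by (rule geometric_tail_limit[OF iterate_tail[OF assms] modulus_nonneg contraction])+

lemma geometric_null: "(\<lambda>n. (\<alpha> * \<beta>) ^ n * C) \<longlonglongrightarrow> 0"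
  using tendsto_mult_left_zero[OF LIMSEQ_power_zero, of "\<alpha> * \<beta>" C] modulus_nonneg contraction by simp

lemma J_bounded: "J \<in> bounded_values"
proof -
  have "J \<in> borel_measurable (restrict_space borel E)"
    by (rule borel_measurable_LIMSEQ_real[of _ iterate])
      (use iterate_limit(1) iterate_bounded in \<open>auto simp: space_restrict_space bounded_values_def\<close>)
  moreover have "K * bl x \<le> J x" "J x \<le> K * bu x" if "x \<in> E" for x
    using iterate_bounded that
    by (auto intro!: LIMSEQ_le_const[OF iterate_limit(1)[OF that]] LIMSEQ_le_const2[OF iterate_limit(1)[OF that]]
        simp: bounded_values_def)
  ultimately show ?thesis by (simp add: bounded_values_def)
qed

lemma J_admissible: "J \<in> admissible"
  unfolding admissible_def
proof (intro CollectI conjI allI J_bounded lsc_onI_sequentially)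
  fix B x xs t
  assume x: "x \<in> {y\<in>E. b y \<le> B}" and xs: "\<And>n::nat. xs n \<in> {y\<in>E. b y \<le> B}" "xs \<longlonglongrightarrow> x" and t: "t < J x"
  \<comment> \<open>On the sublevel set of level B the weighted error is uniform. N makes it smaller
    than half the gap J x - t, one half being spent at x and the other at a term of the
    sequence.\<close>
  obtain N where N: "(\<alpha> * \<beta>) ^ N * (K * B) < (J x - t) / 2"
    using order_tendstoD(2)[OF geometric_null, of "(J x - t) / 2" "K * B"] t
    by (auto dest: eventually_happens)
  have close: "\<bar>J y - iterate N y\<bar> < (J x - t) / 2" if "y \<in> {y\<in>E. b y \<le> B}" for y
  proof -
    have "(\<alpha> * \<beta>) ^ N * (K * b y) \<le> (\<alpha> * \<beta>) ^ N * (K * B)"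
      using that K_pos modulus_nonneg by (intro mult_left_mono) auto
    then show ?thesis using iterate_limit(2)[of y N] N that by auto
  qed
  have "\<forall>\<^sub>F n in sequentially. t + (J x - t) / 2 < iterate N (xs n)"
  proof (rule lsc_onD_sequentially[OF _ x xs])
    show "lsc_on {y\<in>E. b y \<le> B} (iterate N)" using iterate_admissible by (simp add: admissible_def)
    show "t + (J x - t) / 2 < iterate N x" using close[OF x] unfolding abs_diff_less_iff by (simp add: field_simps)
  qed
  then obtain n where "t + (J x - t) / 2 < iterate N (xs n)" by (auto dest: eventually_happens)
  with close[OF xs(1)[of n]] have "t < J (xs n)" by linarith
  then show "\<exists>n. t < J (xs n)" ..
qed

lemma rBellman_J:
  assumes x: "x \<in> E"
  shows "rBellman J x = J x"
proof -
  have "\<bar>iterate (Suc n) x - rBellman J x\<bar> \<le> (\<alpha> * \<beta>) ^ n * (\<alpha> * \<beta> * (K * b x))" for n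
  proof -
    have "\<bar>iterate n y - J y\<bar> \<le> (\<alpha> * \<beta>) ^ n * K * b y" if "y \<in> E" for y
      using iterate_limit(2)[OF that, of n] by (simp add: abs_minus_commute mult.assoc)
    from rBellman_lipschitz[OF J_bounded iterate_bounded _ this x]
    have "\<bar>rBellman (iterate n) x - rBellman J x\<bar> \<le> \<alpha> * \<beta> * ((\<alpha> * \<beta>) ^ n * K * b x)"
      using modulus_nonneg K_pos by simp
    then show ?thesis by (simp only: iterate_Suc mult_ac)
  qed
  then have "(\<lambda>n. iterate (Suc n) x) \<longlonglongrightarrow> rBellman J x"
    using geometric_null by (intro metric_tendsto_imp_tendsto[OF geometric_null, of _ _ "\<alpha> * \<beta> * (K * b x)"])
      (auto simp: dist_real_def intro!: always_eventually order_trans[OF _ abs_ge_self])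
  then show ?thesis
    using LIMSEQ_Suc[OF iterate_limit(1)[OF x]] by (rule LIMSEQ_unique)
qed

lemma Bellman_J: "x \<in> E \<Longrightarrow> Bellman J x = ereal (J x)"
  using Bellman_bounds(1)[OF J_bounded] rBellman_J by simp

lemma J_lsc_between: "J \<in> lsc_between E (\<lambda>x. K * bl x) (\<lambda>x. K * bu x)"
proof -
  have "lsc_on E (rBellman J)" by (rule rBellman_lsc[OF J_admissible])
  then have "lsc_on E J"
    using rBellman_J unfolding lsc_on_def by (auto elim!: eventually_mono simp: eventually_at_filter)
  then show ?thesis using J_bounded by (auto simp: lsc_between_def bounded_values_def)
qed

text \<open>As v is reproduced by n applications of the operator, while \<open>iterate n\<close> is
  the result for 0, the initial bound |v| <= K b contracts to 0 and the iterates converge to v as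
  well as to J.\<close>

lemma fixed_point_unique:
  assumes v: "v \<in> lsc_between E (\<lambda>x. K * bl x) (\<lambda>x. K * bu x)"
    and fix_v: "\<And>x. x \<in> E \<Longrightarrow> Bellman v x = ereal (v x)" and x: "x \<in> E"
  shows "v x = J x"
proof -
  have vb: "v \<in> bounded_values"
    using v by (intro admissible_bounded lsc_admissible) (auto simp: lsc_between_def)
  have Bv: "rBellman v y = v y" if "y \<in> E" for y
    using Bellman_bounds(1)[OF vb that] fix_v[OF that] by simp
  have "\<bar>v y - iterate n y\<bar> \<le> (\<alpha> * \<beta>) ^ n * (K * b y)" if "y \<in> E" for n y
    using that
  proof (induction n arbitrary: y)
    case 0
    then show ?case using bounded_values_abs_le[OF vb] by (simp add: iterate_def)
  next
    case (Suc n)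
    have "\<bar>v y - iterate n y\<bar> \<le> (\<alpha> * \<beta>) ^ n * K * b y" if "y \<in> E" for y
      using Suc.IH[OF that] by (simp add: mult.assoc)
    from rBellman_lipschitz[OF iterate_bounded vb _ this Suc.prems]
    show ?case using modulus_nonneg K_pos Bv[OF Suc.prems] by (simp add: iterate_Suc mult.assoc)
  qed
  then have "(\<lambda>n. iterate n x) \<longlonglongrightarrow> v x"
    using x by (intro metric_tendsto_imp_tendsto[OF geometric_null, of _ _ "K * b x"])
      (auto simp: dist_real_def abs_minus_commute intro!: always_eventually order_trans[OF _ abs_ge_self])
  then show ?thesis using LIMSEQ_unique iterate_limit(1)[OF x] by blast
qed

section \<open>Infinite horizon and stationary policies\<close>

lemma pvalue_limit:
  assumes "\<pi> \<in> Markov_policies E A D" "x \<in> E"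
  shows "(\<lambda>N. pvalue N \<pi> x) \<longlonglongrightarrow> ereal (lim (\<lambda>N. rvalue N \<pi> x))"
  using rvalue_limit[OF assms] by (simp add: pvalue_eq[OF assms])

lemma policy_value_inf_eq:
  "\<pi> \<in> Markov_policies E A D \<Longrightarrow> x \<in> E \<Longrightarrow>
    policy_value_inf \<rho> T Z c \<beta> \<pi> x = ereal (lim (\<lambda>N. rvalue N \<pi> x))"
  unfolding policy_value_inf_def by (rule limI[OF pvalue_limit])

lemma J_le_policy_value_inf:
  assumes "\<pi> \<in> Markov_policies E A D" "x \<in> E"
  shows "ereal (J x) \<le> policy_value_inf \<rho> T Z c \<beta> \<pi> x"
  using LIMSEQ_le[OF iterate_limit(1)[OF assms(2)] rvalue_limit[OF assms]] iterate_le_rvalue[OF assms]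
  by (auto simp: policy_value_inf_eq[OF assms])

text \<open>The condition on d together with the Bellman equation makes J a fixed point of the
  operator of d. The values of the stationary policy are iterates of that operator at 0, so they
  approach J geometrically.\<close>

lemma stationary_optimal:
  assumes d: "d \<in> decision_rules E A D"
    and opt: "\<And>x. x \<in> E \<Longrightarrow> rule_operator \<rho> T Z c \<beta> d J x = Bellman J x" and x: "x \<in> E"
  shows "policy_value_inf \<rho> T Z c \<beta> (\<lambda>_. d) x = ereal (J x)"
proof -
  have \<pi>: "(\<lambda>_. d) \<in> Markov_policies E A D" using d by (simp add: Markov_policies_def)
  have dJ: "rrisk J y (d y) = J y" if "y \<in> E" for y
    using opt[OF that] Bellman_J[OF that] by (simp add: rule_operator_def rrisk_def)
  have "\<bar>rvalue n (\<lambda>_. d) y - J y\<bar> \<le> (\<alpha> * \<beta>) ^ n * (K * b y)" if "y \<in> E" for n y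
    using that
  proof (induction n arbitrary: y)
    case 0
    then show ?case using bounded_values_abs_le[OF J_bounded] by (simp add: rvalue_0)
  next
    case (Suc n)
    have "\<bar>rvalue n (\<lambda>_. d) y - J y\<bar> \<le> (\<alpha> * \<beta>) ^ n * K * b y" if "y \<in> E" for y
      using Suc.IH[OF that] by (simp add: mult.assoc)
    from rrisk_lipschitz[OF decision_rule_in[OF d Suc.prems] J_bounded rvalue_bounded[OF \<pi>] _ this]
    show ?case using modulus_nonneg K_pos dJ[OF Suc.prems] by (simp add: rvalue_Suc mult.assoc)
  qed
  then have "(\<lambda>n. rvalue n (\<lambda>_. d) x) \<longlonglongrightarrow> J x"
    using x by (intro metric_tendsto_imp_tendsto[OF geometric_null, of _ _ "K * b x"])
      (auto simp: dist_real_def intro!: always_eventually order_trans[OF _ abs_ge_self])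
  then show ?thesis unfolding policy_value_inf_eq[OF \<pi> x] by (simp add: limI)
qed

lemma optimal_rule_exists:
  obtains d where "d \<in> decision_rules E A D" "\<And>x. x \<in> E \<Longrightarrow> rule_operator \<rho> T Z c \<beta> d J x = Bellman J x"
  using minimizer[OF J_admissible] unfolding rule_operator_def by metis

text \<open>This justifies exchanging limit and infimum. Value iteration lies below every policy
  value, and the inequality survives the limit for each policy; a stationary minimizing policy gives
  the reverse inequality.\<close>

lemma value_inf_eq:
  assumes x: "x \<in> E"
  shows "value_inf \<rho> E A D T Z c \<beta> x = ereal (J x)"
  unfolding value_inf_def
proof (rule antisym)
  obtain d where d: "d \<in> decision_rules E A D" "\<And>x. x \<in> E \<Longrightarrow> rule_operator \<rho> T Z c \<beta> d J x = Bellman J x"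
    by (rule optimal_rule_exists) blast
  have "(\<lambda>_. d) \<in> Markov_policies E A D" using d by (simp add: Markov_policies_def)
  from INF_lower[OF this, of "\<lambda>\<pi>. policy_value_inf \<rho> T Z c \<beta> \<pi> x"] stationary_optimal[OF d x]
  show "(INF \<pi>\<in>Markov_policies E A D. policy_value_inf \<rho> T Z c \<beta> \<pi> x) \<le> ereal (J x)" by simp
  show "ereal (J x) \<le> (INF \<pi>\<in>Markov_policies E A D. policy_value_inf \<rho> T Z c \<beta> \<pi> x)"
    by (rule INF_greatest) (rule J_le_policy_value_inf[OF _ x])
qed

end

text \<open>The operators act on real-valued functions whereas horizon values are extended reals.
  Hence J appears as a real-valued witness, determined on E by the convergence in a).\<close>

theorem theorem5p5:
  fixes M :: "'w measure" and p :: real and \<rho> :: "('w \<Rightarrow> real) \<Rightarrow> ereal"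
    and E :: "'e::polish_space set" and A :: "'a::polish_space set" and D :: "('e \<times> 'a) set"
    and ZS :: "'z measure" and Z :: "'w \<Rightarrow> 'z" and T :: "'e \<Rightarrow> 'a \<Rightarrow> 'z \<Rightarrow> 'e"
    and c :: "'e \<Rightarrow> 'a \<Rightarrow> 'e \<Rightarrow> real" and \<beta> :: real
    and \<alpha> \<epsilon>l \<epsilon>u :: real and bl bu :: "'e \<Rightarrow> real"
  assumes prob: "prob_space M" and p: "1 \<le> p"
    and E: "E \<in> sets borel" and A: "A \<in> sets borel"
    and D: "D \<in> sets borel" "D \<subseteq> E \<times> A"
    and graph: "decision_rules E A D \<noteq> {}"
    and Z: "Z \<in> M \<rightarrow>\<^sub>M ZS"
    and T: "(\<lambda>((x, a), z). T x a z) \<in> restrict_space borel D \<Otimes>\<^sub>M ZS \<rightarrow>\<^sub>M restrict_space borel E"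
    and \<beta>: "0 < \<beta>" "\<beta> \<le> 1"
    and values_measurable: "\<And>N \<pi>. \<pi> \<in> Markov_policies E A D \<Longrightarrow>
          policy_value \<rho> T Z c \<beta> N \<pi> \<in> borel_measurable (restrict_space borel E)"
    and D_compact: "\<And>x. x \<in> E \<Longrightarrow> compact (D `` {x})"
    and D_usc: "usc_set_valued_on E D"
    and T_continuous: "\<And>z. z \<in> space ZS \<Longrightarrow> continuous_on D (\<lambda>(x, a). T x a z)"
    and c_lsc: "lsc_on (D \<times> E) (\<lambda>((x, a), y). c x a y)"
    and nonneg: "0 \<le> \<alpha>" "0 \<le> \<epsilon>l" "0 \<le> \<epsilon>u" and sum_one: "\<epsilon>l + \<epsilon>u = 1"
    and bl: "bl \<in> borel_measurable (restrict_space borel E)" "\<And>x. x \<in> E \<Longrightarrow> bl x \<le> - \<epsilon>l"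
    and bu: "bu \<in> borel_measurable (restrict_space borel E)" "\<And>x. x \<in> E \<Longrightarrow> \<epsilon>u \<le> bu x"
    and lower_cost: "\<And>x a. (x, a) \<in> D \<Longrightarrow> \<rho> (\<lambda>w. c x a (T x a (Z w))) \<ge> ereal (bl x)"
    and lower_drift: "\<And>x a. (x, a) \<in> D \<Longrightarrow> \<rho> (\<lambda>w. - bl (T x a (Z w))) \<le> ereal (- \<alpha> * bl x)"
    and upper_cost: "\<And>x a. (x, a) \<in> D \<Longrightarrow> \<rho> (\<lambda>w. c x a (T x a (Z w))) \<le> ereal (bu x)"
    and upper_drift: "\<And>x a. (x, a) \<in> D \<Longrightarrow> \<rho> (\<lambda>w. bu (T x a (Z w))) \<le> ereal (\<alpha> * bu x)"
    and local_bound: "\<And>x0 a0. (x0, a0) \<in> D \<Longrightarrow>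
          \<exists>\<epsilon>>0. \<exists>\<Theta>1 \<Theta>2.
            \<Theta>1 \<in> borel_measurable ZS \<and> \<Theta>2 \<in> borel_measurable ZS \<and>
            (\<forall>z\<in>space ZS. 0 \<le> \<Theta>1 z \<and> 0 \<le> \<Theta>2 z) \<and>
            (\<lambda>w. \<Theta>1 (Z w)) \<in> Lp M p \<and> (\<lambda>w. \<Theta>2 (Z w)) \<in> Lp M p \<and>
            (\<forall>z\<in>space ZS. \<forall>(x, a)\<in>D \<inter> cball (x0, a0) \<epsilon>.
               \<bar>c x a (T x a z)\<bar> \<le> \<Theta>1 z \<and> bu (T x a z) - bl (T x a z) \<le> \<Theta>2 z)"
    and risk: "law_invariant M p \<rho>" "proper M p \<rho>" "coherent M p \<rho>" "Fatou_property M p \<rho>"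
    and contraction: "\<alpha> * \<beta> < 1"
  shows
    \<comment> \<open>the policy values are finite and their limits exist\<close>
    "(\<forall>\<pi>\<in>Markov_policies E A D. \<forall>x\<in>E.
        (\<forall>N. \<bar>policy_value \<rho> T Z c \<beta> N \<pi> x\<bar> \<noteq> \<infinity>) \<and>
        convergent (\<lambda>N. policy_value \<rho> T Z c \<beta> N \<pi> x)) \<and>
     (\<exists>J :: 'e \<Rightarrow> real.
        \<comment> \<open>a)\<close>
        (\<forall>x\<in>E. (\<lambda>N. horizon_value \<rho> E A D T Z c \<beta> N x) \<longlonglongrightarrow> ereal (J x)) \<and>
        J \<in> lsc_between E (\<lambda>x. 1 / (1 - \<alpha> * \<beta>) * bl x) (\<lambda>x. 1 / (1 - \<alpha> * \<beta>) * bu x) \<and>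
        (\<forall>x\<in>E. Bellman_operator \<rho> D T Z c \<beta> J x = ereal (J x)) \<and>
        (\<forall>v\<in>lsc_between E (\<lambda>x. 1 / (1 - \<alpha> * \<beta>) * bl x) (\<lambda>x. 1 / (1 - \<alpha> * \<beta>) * bu x).
           (\<forall>x\<in>E. Bellman_operator \<rho> D T Z c \<beta> v x = ereal (v x)) \<longrightarrow> (\<forall>x\<in>E. v x = J x)) \<and>
        \<comment> \<open>b)\<close>
        (\<exists>d\<in>decision_rules E A D. \<forall>x\<in>E.
           rule_operator \<rho> T Z c \<beta> d J x = Bellman_operator \<rho> D T Z c \<beta> J x) \<and>
        \<comment> \<open>c)\<close>
        (\<forall>d\<in>decision_rules E A D.
           (\<forall>x\<in>E. rule_operator \<rho> T Z c \<beta> d J x = Bellman_operator \<rho> D T Z c \<beta> J x) \<longrightarrow>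
           (\<forall>x\<in>E. policy_value_inf \<rho> T Z c \<beta> (\<lambda>n. d) x = value_inf \<rho> E A D T Z c \<beta> x)) \<and>
        (\<forall>x\<in>E. value_inf \<rho> E A D T Z c \<beta> x = ereal (J x)))"
proof -
  interpret stationary_model M p \<rho> E A D ZS Z T c \<beta> \<alpha> bl bu
  proof
    show "0 \<le> p" using p by simp
    show "bl x \<le> 0" if "x \<in> E" for x using bl(2)[OF that] nonneg(2) by simp
    show "0 \<le> bu x" if "x \<in> E" for x using bu(2)[OF that] nonneg(3) by simp
  qed (fact assms)+
  have K: "1 / (1 - \<alpha> * \<beta>) = K" by (simp add: K_def)
  obtain d where d: "d \<in> decision_rules E A D"
    "\<And>x. x \<in> E \<Longrightarrow> rule_operator \<rho> T Z c \<beta> d J x = Bellman_operator \<rho> D T Z c \<beta> J x"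
    by (rule optimal_rule_exists) blast
  show ?thesis
    unfolding K
  proof (intro conjI ballI exI[of _ J] allI impI)
    show "\<exists>d\<in>decision_rules E A D. \<forall>x\<in>E.
        rule_operator \<rho> T Z c \<beta> d J x = Bellman_operator \<rho> D T Z c \<beta> J x"
      using d by blast
  next
    fix \<pi> x assume "\<pi> \<in> Markov_policies E A D" "x \<in> E"
    then show "convergent (\<lambda>N. policy_value \<rho> T Z c \<beta> N \<pi> x)"
      using pvalue_limit by (auto simp: convergent_def)
  next
    fix x assume "x \<in> E"
    then show "(\<lambda>N. horizon_value \<rho> E A D T Z c \<beta> N x) \<longlonglongrightarrow> ereal (J x)"
      using iterate_limit(1) by (simp add: horizon_value_eq)
  next
    fix d x assume *: "d \<in> decision_rules E A D"
      "\<forall>x\<in>E. rule_operator \<rho> T Z c \<beta> d J x = Bellman_operator \<rho> D T Z c \<beta> J x" "x \<in> E"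
    show "policy_value_inf \<rho> T Z c \<beta> (\<lambda>n. d) x = value_inf \<rho> E A D T Z c \<beta> x"
      using stationary_optimal[OF *(1) bspec[OF *(2)] *(3)] value_inf_eq[OF *(3)] by simp
  qed (auto simp: pvalue_eq Bellman_J J_lsc_between value_inf_eq intro: fixed_point_unique)
qed

end
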